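(* Let $\alpha,\beta>0$, let $(a_n)_n$ in $\mathcal{M}(\alpha,\beta,(A_0,A_1))$ be bounded (in $L(H_1)$), let $a\in L(H_1)$, and let $H_1$ be separable. Then the following statements are equivalent: (i) $a\in\mathcal{M}(\alpha,\beta,(A_0,A_1))$, and $(a_n)_n$ nonlocally $H$-converges to $a$ with respect to $(A_0,A_1)$; (ii) for all $(q_n)_n$ in $H_1$ weakly convergent to some $q$ in $H_1$ and for all strictly monotone $\kappa:\mathbb{N}\to\mathbb{N}$ we have: given the two conditions (a) $\big(\mathcal{A}_{0,\mathrm{k}}^\diamond(a_{\kappa(n)}q_n)\big)_n$ is relatively compact in $\operatorname{dom}(\mathcal{A}_0)^*$, (b) $\big((\mathcal{A}_1^* )_{\mathrm{k}}^\diamond(q_n)\big)_n$ is relatively compact in $\operatorname{dom}(\mathcal{A}_1^* )^*$, then $a_{\kappa(n)}q_n\rightharpoonup aq$ weakly in $H_1$ as $n\to\infty$.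
   Context: Hilbert spaces are complex; $L(K_0,K_1)$ denotes bounded linear operators, $L(K)=L(K,K)$. $K^*$ is the space of bounded functionals on $K$, with the convention (linear or conjugate-linear) that $v\mapsto\langle w,v\rangle$ belongs to $K^*$. For $T\in L(K)$, $\operatorname{Re}T=\frac12(T+T^* )$, and $\operatorname{Re}T\ge c$ means $\operatorname{Re}\langle T\phi,\phi\rangle\ge c\|\phi\|^2$ for all $\phi$. Standing setting: $H_0,H_1,H_2$ are Hilbert spaces; $A_0:\operatorname{dom}(A_0)\subseteq H_0\to H_1$ and $A_1:\operatorname{dom}(A_1)\subseteq H_1\to H_2$ are densely defined closed linear operators; $(A_0,A_1)$ is closed and exact, i.e. $\operatorname{ran}(A_0)$, $\operatorname{ran}(A_1)$ are closed and $\operatorname{ran}(A_0)=\ker(A_1)$. Then $H_1=\operatorname{ran}(A_0)\oplus\operatorname{ran}(A_1^* )$ orthogonally. Let $\iota_0:\operatorname{ran}(A_0)\hookrightarrow H_1$ and $\iota_1:\operatorname{ran}(A_1^* )\hookrightarrow H_1$ be the canonical embeddings. For $a\in L(H_1)$ put $a_{jk}=\iota_j^*a\iota_k$ ($j,k\in\{0,1\}$); $a_{00}^{-1}$ means $(a_{00})^{-1}$ and $(a^{-1})_{11}^{-1}$ means $((a^{-1})_{11})^{-1}$. $\mathcal{M}(\alpha,\beta,(A_0,A_1))$ is the set of continuously invertible $a\in L(H_1)$ with $\operatorname{Re}a_{00}\ge\alpha$, $\operatorname{Re}a_{00}^{-1}\ge1/\beta$, $\operatorname{Re}(a^{-1})_{11}\ge1/\beta$,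 $\operatorname{Re}(a^{-1})_{11}^{-1}\ge\alpha$. Let $\mathcal{A}_0$ be $A_0$ restricted to $\operatorname{dom}(\mathcal{A}_0)=\operatorname{dom}(A_0)\cap\operatorname{ran}(A_0^* )$ (note $\operatorname{ran}(A_0^* )=\ker(A_0)^\perp$), with values in $\operatorname{ran}(A_0)$, and $\mathcal{A}_1^*$ be $A_1^*$ restricted to $\operatorname{dom}(\mathcal{A}_1^* )=\operatorname{dom}(A_1^* )\cap\operatorname{ran}(A_1)$, with values in $\operatorname{ran}(A_1^* )$; domains carry graph norms. Define $\mathcal{A}_0^\diamond:\operatorname{ran}(A_0)\to\operatorname{dom}(\mathcal{A}_0)^*$, $\phi\mapsto(v\mapsto\langle\phi,A_0v\rangle)$ and $(\mathcal{A}_1^* )^\diamond:\operatorname{ran}(A_1^* )\to\operatorname{dom}(\mathcal{A}_1^* )^*$, $\phi\mapsto(v\mapsto\langle\phi,A_1^*v\rangle)$. With $\pi_0,\pi_1$ the orthogonal projections in $H_1$ onto $\operatorname{ran}(A_0)$, $\operatorname{ran}(A_1^* )$, put $\mathcal{A}_{0,\mathrm{k}}^\diamond(\phi)=\mathcal{A}_0^\diamond(\pi_0\phi)$ and $(\mathcal{A}_1^* )_{\mathrm{k}}^\diamond(\phi)=(\mathcal{A}_1^* )^\diamond(\pi_1\phi)$ for $\phi\in H_1$. Nonlocal $H$-convergence: a sequence $(a_n)_n$ in $\mathcal{M}(\alpha,\beta,(A_0,A_1))$ is nonlocally $H$-convergent to a continuously invertible $a\in L(H_1)$ with respect to $(A_0,A_1)$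 if for all $f\in\operatorname{dom}(\mathcal{A}_0)^*$ and $g\in\operatorname{dom}(\mathcal{A}_1^* )^*$, the (unique) $u_n\in\operatorname{dom}(\mathcal{A}_0)$, $v_n\in\operatorname{dom}(\mathcal{A}_1^* )$ with $\langle a_nA_0u_n,A_0\phi\rangle=f(\phi)$ and $\langle a_n^{-1}A_1^*v_n,A_1^*\psi\rangle=g(\psi)$ for all $\phi\in\operatorname{dom}(\mathcal{A}_0)$, $\psi\in\operatorname{dom}(\mathcal{A}_1^* )$ satisfy: $u_n\rightharpoonup u$ weakly in $\operatorname{dom}(A_0)$ for some $u$; $v_n\rightharpoonup v$ weakly in $\operatorname{dom}(A_1^* )$ for some $v$; $a_nA_0u_n\rightharpoonup aA_0u$ and $a_n^{-1}A_1^*v_n\rightharpoonup a^{-1}A_1^*v$ weakly in $H_1$; and $\langle aA_0u,A_0\phi\rangle=f(\phi)$, $\langle a^{-1}A_1^*v,A_1^*\psi\rangle=g(\psi)$ for all $\phi\in\operatorname{dom}(\mathcal{A}_0)$, $\psi\in\operatorname{dom}(\mathcal{A}_1^* )$. *)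

theory Defs
  imports "HOL-Analysis.Analysis"
begin

section \<open>Complex Hilbert spaces\<close>

text \<open>
  A complex inner product space is a real one (with the real part as its real inner
  product, so that norm and topology are those of the library) together with a complex scalar
  multiplication and a sesquilinear form. The form is linear in the \<^emph>\<open>second\<close> argument, so that
  \<open>\<lambda>v. cinner w v\<close> is a linear functional. Positive definiteness is inherited from
  \<^class>\<open>real_inner\<close>.
\<close>

class complex_inner = real_inner +
  fixes scaleC :: "complex \<Rightarrow> 'a \<Rightarrow> 'a"  (infixr "*\<^sub>C" 75)
    and cinner :: "'a \<Rightarrow> 'a \<Rightarrow> complex"
  assumes scaleC_add_right: "c *\<^sub>C (x + y) = c *\<^sub>C x + c *\<^sub>C y"
    and scaleC_add_left: "(c + d) *\<^sub>C x = c *\<^sub>C x + d *\<^sub>C x"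
    and scaleC_scaleC: "c *\<^sub>C d *\<^sub>C x = (c * d) *\<^sub>C x"
    and scaleC_of_real: "complex_of_real r *\<^sub>C x = r *\<^sub>R x"
    and cinner_commute: "cinner x y = cnj (cinner y x)"
    and cinner_add_right: "cinner x (y + z) = cinner x y + cinner x z"
    and cinner_scaleC_right: "cinner x (c *\<^sub>C y) = c * cinner x y"
    and Re_cinner: "Re (cinner x y) = inner x y"

class chilbert_space = complex_inner + complete_space

instantiation complex :: chilbert_space
begin

definition scaleC_complex :: "complex \<Rightarrow> complex \<Rightarrow> complex"
  where "scaleC_complex c x = c * x"

definition cinner_complex :: "complex \<Rightarrow> complex \<Rightarrow> complex"
  where "cinner_complex x y = cnj x * y"

instance
  by standard
    (auto simp: scaleC_complex_def cinner_complex_def inner_complex_def algebra_simps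
      scaleR_conv_of_real)

end

global_interpretation complex_vector:
  vector_space "scaleC :: complex \<Rightarrow> 'a \<Rightarrow> 'a::complex_inner"
  defines csubspace = complex_vector.subspace
proof
  fix x :: 'a
  show "1 *\<^sub>C x = x"
    using scaleC_of_real[of 1 x] by simp
qed (simp_all add: scaleC_add_right scaleC_add_left scaleC_scaleC)

definition clinear_on :: "'a::complex_inner set \<Rightarrow> ('a \<Rightarrow> 'b::complex_inner) \<Rightarrow> bool" where
  "clinear_on S f \<longleftrightarrow>
     (\<forall>x\<in>S. \<forall>y\<in>S. f (x + y) = f x + f y) \<and> (\<forall>c. \<forall>x\<in>S. f (c *\<^sub>C x) = c *\<^sub>C f x)"

text \<open>
  Closed subspaces are treated as Hilbert spaces in their own right. \<open>bounded_ops S T\<close> is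
  $L(S,T)$; values outside \<open>S\<close> are irrelevant.
\<close>

definition bounded_ops ::
    "'a::complex_inner set \<Rightarrow> 'b::complex_inner set \<Rightarrow> ('a \<Rightarrow> 'b) set" where
  "bounded_ops S T =
     {f. f ` S \<subseteq> T \<and> clinear_on S f \<and> (\<exists>C. \<forall>x\<in>S. norm (f x) \<le> C * norm x)}"

definition cont_invertible :: "'a::complex_inner set \<Rightarrow> ('a \<Rightarrow> 'a) \<Rightarrow> bool" where
  "cont_invertible S f \<longleftrightarrow>
     f \<in> bounded_ops S S \<and> bij_betw f S S \<and> inv_into S f \<in> bounded_ops S S"

definition Re_ge :: "'a::complex_inner set \<Rightarrow> ('a \<Rightarrow> 'a) \<Rightarrow> real \<Rightarrow> bool" where
  "Re_ge S f c \<longleftrightarrow> (\<forall>x\<in>S. Re (cinner (f x) x) \<ge> c * (norm x)\<^sup>2)"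

text \<open>The adjoint $\iota^* : H \to S$ of the canonical embedding $\iota : S \to H$.\<close>

definition embedding_adjoint :: "'a::complex_inner set \<Rightarrow> 'a \<Rightarrow> 'a" where
  "embedding_adjoint S x = (THE y. y \<in> S \<and> (\<forall>s\<in>S. cinner y s = cinner x s))"

definition orth_proj :: "'a::complex_inner set \<Rightarrow> 'a \<Rightarrow> 'a" where
  "orth_proj S x = (THE y. y \<in> S \<and> (\<forall>s\<in>S. cinner (x - y) s = 0))"

text \<open>$\iota_S^* \, a \, \iota_T$, to be regarded as a map from \<open>T\<close> to \<open>S\<close>.\<close>

definition block ::
    "'a::complex_inner set \<Rightarrow> 'a set \<Rightarrow> ('a \<Rightarrow> 'a) \<Rightarrow> 'a \<Rightarrow> 'a" where
  "block S T a = (\<lambda>x\<in>T. embedding_adjoint S (a x))"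


section \<open>Dual spaces and weak convergence\<close>

text \<open>
  \<open>D\<close> is a linear subspace of the ambient type, normed by \<open>N\<close>. Functionals on \<open>D\<close> are
  represented by functions that are \<open>undefined\<close> off \<open>D\<close>, so that equality of functionals is
  equality of functions.
\<close>

definition normed_dual ::
    "'a::complex_inner set \<Rightarrow> ('a \<Rightarrow> real) \<Rightarrow> ('a \<Rightarrow> complex) set" where
  "normed_dual D N =
     {f \<in> extensional D. clinear_on D f \<and> (\<exists>C. \<forall>v\<in>D. cmod (f v) \<le> C * N v)}"

definition dual_norm :: "'a set \<Rightarrow> ('a \<Rightarrow> real) \<Rightarrow> ('a \<Rightarrow> complex) \<Rightarrow> real" where
  "dual_norm D N f = (SUP v\<in>D. cmod (f v) / N v)"

text \<open>
  The value \<open>0\<close> outside the dual is a convention; \<^locale>\<open>Metric_space\<close> demands nonnegativity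
  and symmetry for all arguments.
\<close>

definition dual_dist ::
    "'a::complex_inner set \<Rightarrow> ('a \<Rightarrow> real) \<Rightarrow> ('a \<Rightarrow> complex) \<Rightarrow> ('a \<Rightarrow> complex) \<Rightarrow> real" where
  "dual_dist D N f g =
     (if f \<in> normed_dual D N \<and> g \<in> normed_dual D N
      then dual_norm D N (\<lambda>v. f v - g v) else 0)"

definition dual_topology ::
    "'a::complex_inner set \<Rightarrow> ('a \<Rightarrow> real) \<Rightarrow> ('a \<Rightarrow> complex) topology" where
  "dual_topology D N = Metric_space.mtopology (normed_dual D N) (dual_dist D N)"

lemma Metric_space_dual:
  assumes "D \<noteq> {}" and N: "\<And>v. v \<in> D \<Longrightarrow> 0 \<le> N v"
  shows "Metric_space (normed_dual D N) (dual_dist D N)"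
proof -
  let ?M = "normed_dual D N"
  have bdd: "bdd_above ((\<lambda>v. cmod (f v - g v) / N v) ` D)"
    if "f \<in> ?M" "g \<in> ?M" for f g
  proof -
    obtain C C' where C: "\<And>v. v \<in> D \<Longrightarrow> cmod (f v) \<le> C * N v"
      and C': "\<And>v. v \<in> D \<Longrightarrow> cmod (g v) \<le> C' * N v"
      using \<open>f \<in> ?M\<close> \<open>g \<in> ?M\<close> unfolding normed_dual_def by auto
    have "cmod (f v - g v) / N v \<le> \<bar>C + C'\<bar>" if "v \<in> D" for v
    proof (cases "N v = 0")
      case False
      have "cmod (f v - g v) \<le> (C + C') * N v"
        using C[OF that] C'[OF that] norm_triangle_ineq4[of "f v" "g v"]
        by (simp add: distrib_right)
      then have "cmod (f v - g v) / N v \<le> C + C'"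
        using N[OF that] False by (simp add: pos_divide_le_eq)
      then show ?thesis by simp
    qed simp
    then show ?thesis by (rule bdd_aboveI2)
  qed
  have le: "cmod (f v - g v) \<le> dual_dist D N f g * N v"
    if "f \<in> ?M" "g \<in> ?M" "v \<in> D" for f g v
  proof (cases "N v = 0")
    case True
    then show ?thesis
      using that unfolding normed_dual_def by force
  next
    case False
    have "cmod (f v - g v) / N v \<le> dual_dist D N f g"
      using cSUP_upper[OF \<open>v \<in> D\<close> bdd] that by (simp add: dual_dist_def dual_norm_def)
    then show ?thesis
      using N[OF \<open>v \<in> D\<close>] False by (simp add: pos_divide_le_eq)
  qed
  have nonneg: "0 \<le> dual_dist D N f g" for f g
  proof (cases "f \<in> ?M \<and> g \<in> ?M")
    case True
    obtain v where "v \<in> D" using assms(1) by blast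
    have "0 \<le> cmod (f v - g v) / N v" using N[OF \<open>v \<in> D\<close>] by simp
    also have "\<dots> \<le> dual_dist D N f g"
      using cSUP_upper[OF \<open>v \<in> D\<close> bdd] True by (simp add: dual_dist_def dual_norm_def)
    finally show ?thesis .
  qed (auto simp: dual_dist_def)
  have upper: "dual_dist D N f g \<le> C"
    if "f \<in> ?M" "g \<in> ?M" "0 \<le> C" "\<And>v. v \<in> D \<Longrightarrow> cmod (f v - g v) \<le> C * N v" for f g C
  proof -
    have "cmod (f v - g v) / N v \<le> C" if "v \<in> D" for v
      using N[OF that] \<open>0 \<le> C\<close> \<open>\<And>v. v \<in> D \<Longrightarrow> cmod (f v - g v) \<le> C * N v\<close>[OF that]
      by (cases "N v = 0") (auto simp: pos_divide_le_eq)
    then show ?thesis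
      using that(1,2) assms(1) by (auto simp: dual_dist_def dual_norm_def intro: cSUP_least)
  qed
  show ?thesis
  proof
    fix f g
    show "0 \<le> dual_dist D N f g" by (rule nonneg)
    show "dual_dist D N f g = dual_dist D N g f"
      by (simp add: dual_dist_def dual_norm_def norm_minus_commute)
  next
    fix f g assume fg: "f \<in> ?M" "g \<in> ?M"
    show "dual_dist D N f g = 0 \<longleftrightarrow> f = g"
    proof
      assume "dual_dist D N f g = 0"
      then have "f v = g v" if "v \<in> D" for v
        using le[OF fg that] by simp
      then show "f = g"
        using fg by (auto simp: normed_dual_def intro: extensionalityI)
    next
      assume "f = g"
      then show "dual_dist D N f g = 0"
        using upper[OF fg, of 0] nonneg[of f g] by simp
    qed
  next
    fix f g h assume fgh: "f \<in> ?M" "g \<in> ?M" "h \<in> ?M"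
    show "dual_dist D N f h \<le> dual_dist D N f g + dual_dist D N g h"
    proof (rule upper[OF fgh(1,3)])
      fix v assume "v \<in> D"
      then show "cmod (f v - h v) \<le> (dual_dist D N f g + dual_dist D N g h) * N v"
        using le[OF fgh(1,2)] le[OF fgh(2,3)] norm_triangle_ineq[of "f v - g v" "g v - h v"]
        by (force simp: distrib_right)
    qed (simp add: nonneg)
  qed
qed

definition relatively_compact_in :: "'a topology \<Rightarrow> 'a set \<Rightarrow> bool" where
  "relatively_compact_in X S \<longleftrightarrow> S \<subseteq> topspace X \<and> compactin X (X closure_of S)"

definition weakly_converges_in ::
    "'a::complex_inner set \<Rightarrow> ('a \<Rightarrow> real) \<Rightarrow> (nat \<Rightarrow> 'a) \<Rightarrow> 'a \<Rightarrow> bool" where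
  "weakly_converges_in D N x l \<longleftrightarrow>
     l \<in> D \<and> (\<forall>n. x n \<in> D) \<and> (\<forall>f\<in>normed_dual D N. (\<lambda>n. f (x n)) \<longlonglongrightarrow> f l)"

abbreviation weakly_converges :: "(nat \<Rightarrow> 'a::complex_inner) \<Rightarrow> 'a \<Rightarrow> bool" where
  "weakly_converges \<equiv> weakly_converges_in UNIV norm"


section \<open>Unbounded operators\<close>

text \<open>
  An unbounded operator is a partial function \<open>A :: 'a \<rightharpoonup> 'b\<close>, with domain \<^term>\<open>dom A\<close>, range
  \<^term>\<open>ran A\<close>, graph \<^term>\<open>Map.graph A\<close> and restrictions \<^term>\<open>A |` S\<close> from the library.
\<close>

abbreviation app :: "('a \<rightharpoonup> 'b) \<Rightarrow> 'a \<Rightarrow> 'b"  (infixr "\<cdot>" 90) where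
  "A \<cdot> x \<equiv> the (A x)"

definition kern :: "('a \<rightharpoonup> 'b::zero) \<Rightarrow> 'a set" where
  "kern A = {x. A x = Some 0}"

definition closed_densely_defined :: "('a::complex_inner \<rightharpoonup> 'b::complex_inner) \<Rightarrow> bool" where
  "closed_densely_defined A \<longleftrightarrow>
     csubspace (dom A) \<and> clinear_on (dom A) (\<lambda>x. A \<cdot> x) \<and>
     closure (dom A) = UNIV \<and> closed (Map.graph A)"

definition closed_exact ::
    "('a::complex_inner \<rightharpoonup> 'b::complex_inner) \<Rightarrow> ('b \<rightharpoonup> 'c::complex_inner) \<Rightarrow> bool" where
  "closed_exact A0 A1 \<longleftrightarrow> closed (ran A0) \<and> closed (ran A1) \<and> ran A0 = kern A1"

text \<open>The uniqueness in the condition below is automatic for densely defined \<open>A\<close>.\<close>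

definition adj :: "('a::complex_inner \<rightharpoonup> 'b::complex_inner) \<Rightarrow> 'b \<rightharpoonup> 'a" where
  "adj A = (\<lambda>y. if \<exists>!z. \<forall>x\<in>dom A. cinner y (A \<cdot> x) = cinner z x
                then Some (THE z. \<forall>x\<in>dom A. cinner y (A \<cdot> x) = cinner z x)
                else None)"

definition graph_norm :: "('a::complex_inner \<rightharpoonup> 'b::complex_inner) \<Rightarrow> 'a \<Rightarrow> real" where
  "graph_norm A x = sqrt ((norm x)\<^sup>2 + (norm (A \<cdot> x))\<^sup>2)"

abbreviation dom_dual :: "('a::complex_inner \<rightharpoonup> 'b::complex_inner) \<Rightarrow> ('a \<Rightarrow> complex) set" where
  "dom_dual A \<equiv> normed_dual (dom A) (graph_norm A)"

abbreviation dom_dual_topology ::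
    "('a::complex_inner \<rightharpoonup> 'b::complex_inner) \<Rightarrow> ('a \<Rightarrow> complex) topology" where
  "dom_dual_topology A \<equiv> dual_topology (dom A) (graph_norm A)"

abbreviation weakly_converges_dom ::
    "('a::complex_inner \<rightharpoonup> 'b::complex_inner) \<Rightarrow> (nat \<Rightarrow> 'a) \<Rightarrow> 'a \<Rightarrow> bool" where
  "weakly_converges_dom A \<equiv> weakly_converges_in (dom A) (graph_norm A)"

text \<open>$\mathcal{A}_0$ and $\mathcal{A}_1^*$.\<close>

definition red0 :: "('a::complex_inner \<rightharpoonup> 'b::complex_inner) \<Rightarrow> 'a \<rightharpoonup> 'b" where
  "red0 A0 = A0 |` ran (adj A0)"

definition red1 :: "('b::complex_inner \<rightharpoonup> 'c::complex_inner) \<Rightarrow> 'c \<rightharpoonup> 'b" where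
  "red1 A1 = adj A1 |` ran A1"

definition diamond ::
    "('a::complex_inner \<rightharpoonup> 'b::complex_inner) \<Rightarrow> 'b \<Rightarrow> 'a \<Rightarrow> complex" where
  "diamond B \<phi> = (\<lambda>v\<in>dom B. cinner \<phi> (B \<cdot> v))"

text \<open>$\mathcal{A}_{0,\mathrm{k}}^\diamond$ and $(\mathcal{A}_1^*)_{\mathrm{k}}^\diamond$.\<close>

definition diamond_k0 ::
    "('a::complex_inner \<rightharpoonup> 'b::complex_inner) \<Rightarrow> 'b \<Rightarrow> 'a \<Rightarrow> complex" where
  "diamond_k0 A0 \<phi> = diamond (red0 A0) (orth_proj (ran A0) \<phi>)"

definition diamond_k1 ::
    "('b::complex_inner \<rightharpoonup> 'c::complex_inner) \<Rightarrow> 'b \<Rightarrow> 'c \<Rightarrow> complex" where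
  "diamond_k1 A1 \<phi> = diamond (red1 A1) (orth_proj (ran (adj A1)) \<phi>)"


section \<open>Nonlocal H-convergence\<close>

text \<open>
  The invertibility of the two diagonal blocks, which follows from the lower bounds on their
  real parts when \<open>\<alpha>, \<beta> > 0\<close>, is listed because the blocks' inverses occur.
\<close>

definition M_class ::
    "real \<Rightarrow> real \<Rightarrow> ('a::complex_inner \<rightharpoonup> 'b::complex_inner) \<Rightarrow> ('b \<rightharpoonup> 'c::complex_inner)
      \<Rightarrow> ('b \<Rightarrow> 'b) set" where
  "M_class \<alpha> \<beta> A0 A1 =
     {a. let R0 = ran A0; R1 = ran (adj A1);
             a00 = block R0 R0 a; ai11 = block R1 R1 (inv a)
         in cont_invertible UNIV a \<and> cont_invertible R0 a00 \<and> cont_invertible R1 ai11 \<and>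
            Re_ge R0 a00 \<alpha> \<and> Re_ge R0 (inv_into R0 a00) (1 / \<beta>) \<and>
            Re_ge R1 ai11 (1 / \<beta>) \<and> Re_ge R1 (inv_into R1 ai11) \<alpha>}"

definition solves ::
    "('b::complex_inner \<Rightarrow> 'b) \<Rightarrow> ('a::complex_inner \<rightharpoonup> 'b) \<Rightarrow> ('a \<Rightarrow> complex) \<Rightarrow> 'b \<Rightarrow> bool" where
  "solves a B f w \<longleftrightarrow> (\<forall>\<phi>\<in>dom B. cinner (a w) (B \<cdot> \<phi>) = f \<phi>)"

text \<open>The unique \<open>u\<close> in \<^term>\<open>dom B\<close> with $\langle a B u, B \phi\rangle = f(\phi)$ for all \<open>\<phi>\<close> in \<^term>\<open>dom B\<close>.\<close>

definition solution ::
    "('b::complex_inner \<Rightarrow> 'b) \<Rightarrow> ('a::complex_inner \<rightharpoonup> 'b) \<Rightarrow> ('a \<Rightarrow> complex) \<Rightarrow> 'a" where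
  "solution a B f = (THE u. u \<in> dom B \<and> solves a B f (B \<cdot> u))"

definition nonlocal_H_converges ::
    "('a::complex_inner \<rightharpoonup> 'b::complex_inner) \<Rightarrow> ('b \<rightharpoonup> 'c::complex_inner)
      \<Rightarrow> (nat \<Rightarrow> 'b \<Rightarrow> 'b) \<Rightarrow> ('b \<Rightarrow> 'b) \<Rightarrow> bool" where
  "nonlocal_H_converges A0 A1 a_seq a \<longleftrightarrow>
     cont_invertible UNIV a \<and>
     (\<forall>f\<in>dom_dual (red0 A0). \<forall>g\<in>dom_dual (red1 A1).
        let u_seq = (\<lambda>n. solution (a_seq n) (red0 A0) f);
            v_seq = (\<lambda>n. solution (inv (a_seq n)) (red1 A1) g)
        in \<exists>u v.
          weakly_converges_dom A0 u_seq u \<and>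
          weakly_converges_dom (adj A1) v_seq v \<and>
          weakly_converges (\<lambda>n. a_seq n (A0 \<cdot> u_seq n)) (a (A0 \<cdot> u)) \<and>
          weakly_converges (\<lambda>n. inv (a_seq n) (adj A1 \<cdot> v_seq n)) (inv a (adj A1 \<cdot> v)) \<and>
          solves a (red0 A0) f (A0 \<cdot> u) \<and>
          solves (inv a) (red1 A1) g (adj A1 \<cdot> v))"

end

theory Submission
  imports Defs "HOL-Complex_Analysis.Great_Picard"
begin

text \<open>
  Put \<open>R\<^sub>0 = ran A\<^sub>0\<close> and \<open>R\<^sub>1 = ran A\<^sub>1\<^sup>*\<close>, with orthogonal projections \<open>P\<^sub>0\<close> and \<open>P\<^sub>1\<close>. By the closed
  range theorem and exactness, \<open>R\<^sub>1 = (ker A\<^sub>1)\<^sup>\<bottom> = R\<^sub>0\<^sup>\<bottom>\<close>, so \<open>H\<^sub>1 = R\<^sub>0 \<oplus> R\<^sub>1\<close>. The two reduced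
  operators are boundedly invertible onto \<open>R\<^sub>0\<close> and \<open>R\<^sub>1\<close> (open mapping theorem), hence by Riesz'
  theorem the diamond maps identify \<open>R\<^sub>0\<close> and \<open>R\<^sub>1\<close> with the duals of their domains. Under
  this identification the unbounded operators disappear: the first family of problems asks for
  \<open>w \<in> R\<^sub>0\<close> with \<open>P\<^sub>0 (a w) = P\<^sub>0 x\<close>, the second for \<open>z \<in> R\<^sub>1\<close> with \<open>P\<^sub>1 (a\<^sup>-\<^sup>1 z) = P\<^sub>1 x\<close>. This is
  the content of the locale \<open>reduced_operator\<close>.

  Both families are instances of one equation. Let \<open>B(a) q = P\<^sub>0 (a q) + P\<^sub>1 q\<close>, called \<open>mixed a\<close>
  below. It is invertible as soon as \<open>a\<close> is coercive on \<open>R\<^sub>0\<close>, with a bound on its inverse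
  \<open>T(a)\<close> that depends only on the constants. The first problem has the solution
  \<open>w = T(a) P\<^sub>0 x\<close>, and the second \<open>z = a T(a) P\<^sub>1 x\<close>. Hence \<open>a\<^sub>n\<close> converges
  to \<open>a\<close> in the nonlocal sense if and only if \<open>T(a\<^sub>n) \<rightarrow> T(a)\<close> and \<open>a\<^sub>n T(a\<^sub>n) \<rightarrow> a T(a)\<close> in the weak
  operator topology (\<open>nonlocal_H_converges_iff_mixed_converges\<close>). The two compactness
  conditions, on the other hand, say that \<open>x\<^sub>n = B(a\<^bsub>\<kappa>(n)\<^esub>) q\<^sub>n\<close> is relatively compact.

  For the forward implication, choose a subsequence along which \<open>x\<^sub>n \<rightarrow> x\<close> in norm. Then
  \<open>q\<^sub>n = T(a\<^bsub>\<kappa>(n)\<^esub>) x\<^sub>n\<close> converges weakly to \<open>T(a) x\<close>, so \<open>q = T(a) x\<close>, and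
  \<open>a\<^bsub>\<kappa>(n)\<^esub> q\<^sub>n\<close> converges weakly to \<open>a T(a) x = a q\<close>
  (\<open>mixed_converges_imp_product_converges\<close>).

  For the converse, separability yields a subsequence along which \<open>T(a\<^sub>n)\<close> converges
  in the weak operator topology to some \<open>S\<close>. The choice \<open>q\<^sub>n = T(a\<^sub>n) x\<close>, for which
  \<open>B(a\<^sub>n) q\<^sub>n = x\<close> is constant, gives \<open>a\<^sub>n T(a\<^sub>n) x \<rightarrow> a S x\<close> weakly, and therefore \<open>B(a) S = 1\<close>.
  The four bounds that define the class are bounds for \<open>T(a\<^sub>n)\<close> on \<open>R\<^sub>0\<close> and for \<open>a\<^sub>n T(a\<^sub>n)\<close>
  on \<open>R\<^sub>1\<close> and survive weak limits. They make \<open>S\<close> coercive on \<open>R\<^sub>0\<close> and \<open>a S\<close> coercive on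
  \<open>R\<^sub>1\<close>, so \<open>B(a)\<close> and \<open>a\<close> are invertible, \<open>a\<close> belongs to the class, and \<open>S = T(a)\<close> is
  independent of the subsequence (\<open>product_converges_imp_M\<close>,
  \<open>product_converges_imp_mixed_converges\<close>).
\<close>

section \<open>Complex inner product spaces\<close>

instance chilbert_space \<subseteq> banach ..

lemma cinner_add_left: "cinner (x + y) z = cinner x z + cinner y z"
  by (metis cinner_add_right cinner_commute complex_cnj_add)

lemma cinner_scaleC_left: "cinner (c *\<^sub>C x) y = cnj c * cinner x y"
  by (metis cinner_commute cinner_scaleC_right complex_cnj_mult)

lemma cinner_zero [simp]: "cinner 0 x = 0" "cinner x 0 = 0"
  by (metis add_cancel_right_right cinner_add_left) (metis add_cancel_right_right cinner_add_right)

lemma cinner_minus_left: "cinner (- x) y = - cinner x y"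
  by (metis cinner_add_left cinner_zero(1) add.right_inverse add_eq_0_iff)

lemma cinner_minus_right: "cinner x (- y) = - cinner x y"
  by (metis cinner_add_right cinner_zero(2) add.right_inverse add_eq_0_iff)

lemma cinner_diff_left: "cinner (x - y) z = cinner x z - cinner y z"
  using cinner_add_left[of x "- y" z] by (simp add: cinner_minus_left)

lemma cinner_diff_right: "cinner x (y - z) = cinner x y - cinner x z"
  using cinner_add_right[of x y "- z"] by (simp add: cinner_minus_right)

lemmas cinner_simps = cinner_add_left cinner_add_right cinner_diff_left cinner_diff_right
  cinner_minus_left cinner_minus_right cinner_scaleC_left cinner_scaleC_right

lemma cinner_self: "cinner x x = complex_of_real ((norm x)\<^sup>2)"
proof (rule complex_eqI)
  show "Re (cinner x x) = Re (complex_of_real ((norm x)\<^sup>2))"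
    by (simp add: Re_cinner dot_square_norm)
  have "Im (cinner x x) = Im (cnj (cinner x x))"
    using cinner_commute[of x x] by simp
  then show "Im (cinner x x) = Im (complex_of_real ((norm x)\<^sup>2))"
    by simp
qed

lemma Re_cinner_commute: "Re (cinner x y) = Re (cinner y x)"
  by (simp add: Re_cinner inner_commute)

lemma norm_scaleC [simp]: "norm (c *\<^sub>C x) = cmod c * norm x"
proof -
  have "cinner (c *\<^sub>C x) (c *\<^sub>C x) = (c * cnj c) * cinner x x"
    by (simp add: cinner_scaleC_left cinner_scaleC_right)
  also have "\<dots> = complex_of_real ((cmod c * norm x)\<^sup>2)"
    unfolding complex_norm_square[symmetric] cinner_self by (simp add: power_mult_distrib)
  finally have "(norm (c *\<^sub>C x))\<^sup>2 = (cmod c * norm x)\<^sup>2"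
    unfolding cinner_self of_real_eq_iff .
  then show ?thesis
    by (simp add: power2_eq_iff_nonneg)
qed

lemma norm_cinner_le: "cmod (cinner x y) \<le> norm x * norm y"
proof (cases "cinner x y = 0")
  case False
  define u where "u = cnj (cinner x y) / cmod (cinner x y)"
  have u: "cmod u = 1"
    using False by (simp add: u_def norm_divide)
  have "u * cinner x y = cmod (cinner x y)"
    using False by (simp add: u_def complex_norm_square[symmetric] power2_eq_square mult.commute)
  then have "cmod (cinner x y) = Re (cinner x (u *\<^sub>C y))"
    by (simp add: cinner_simps)
  also have "\<dots> \<le> norm x * norm (u *\<^sub>C y)"
    unfolding Re_cinner by (rule norm_cauchy_schwarz)
  finally show ?thesis
    by (simp add: u)
qed simp

lemma tendsto_cinner [tendsto_intros]:
  fixes x y :: "'a::complex_inner"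
  assumes "(f \<longlongrightarrow> x) F" and "(g \<longlongrightarrow> y) F"
  shows "((\<lambda>n. cinner (f n) (g n)) \<longlongrightarrow> cinner x y) F"
proof -
  have Im: "Im (cinner u v) = inner (\<i> *\<^sub>C u) v" for u v :: 'a
    by (simp add: Re_cinner[symmetric] cinner_simps)
  have "bounded_linear (\<lambda>u::'a. \<i> *\<^sub>C u)"
  proof
    fix r :: real and u :: 'a
    show "\<i> *\<^sub>C r *\<^sub>R u = r *\<^sub>R \<i> *\<^sub>C u"
      by (simp add: scaleC_of_real[symmetric] scaleC_scaleC mult.commute)
    show "\<exists>K. \<forall>x::'a. norm (\<i> *\<^sub>C x) \<le> norm x * K"
      by (auto intro: exI[of _ 1])
  qed (rule scaleC_add_right)
  then have "((\<lambda>n. \<i> *\<^sub>C f n) \<longlongrightarrow> \<i> *\<^sub>C x) F"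
    using assms(1) by (rule bounded_linear.tendsto)
  then have "((\<lambda>n. Im (cinner (f n) (g n))) \<longlongrightarrow> Im (cinner x y)) F"
    unfolding Im using assms(2) by (rule tendsto_inner)
  moreover have "((\<lambda>n. Re (cinner (f n) (g n))) \<longlongrightarrow> Re (cinner x y)) F"
    unfolding Re_cinner using assms by (rule tendsto_inner)
  ultimately show ?thesis
    by (simp add: tendsto_complex_iff)
qed

lemma csubspace_scaleR: "csubspace S \<Longrightarrow> x \<in> S \<Longrightarrow> r *\<^sub>R x \<in> S"
  unfolding scaleC_of_real[symmetric] by (rule complex_vector.subspace_scale)

lemma csubspace_imp_subspace: "csubspace S \<Longrightarrow> subspace S"
  unfolding subspace_def
  using complex_vector.subspace_add complex_vector.subspace_0 csubspace_scaleR by blast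

lemma clinear_on_add: "clinear_on S f \<Longrightarrow> x \<in> S \<Longrightarrow> y \<in> S \<Longrightarrow> f (x + y) = f x + f y"
  and clinear_on_scaleC: "clinear_on S f \<Longrightarrow> x \<in> S \<Longrightarrow> f (c *\<^sub>C x) = c *\<^sub>C f x"
  by (auto simp: clinear_on_def)

lemma clinear_on_scaleR: "clinear_on S f \<Longrightarrow> x \<in> S \<Longrightarrow> f (r *\<^sub>R x) = r *\<^sub>R f x"
  unfolding scaleC_of_real[symmetric] by (rule clinear_on_scaleC)

lemma clinear_on_0: "clinear_on S f \<Longrightarrow> csubspace S \<Longrightarrow> f 0 = 0"
  using clinear_on_scaleR[of S f 0 0] complex_vector.subspace_0 by fastforce

lemma clinear_on_diff:
  assumes "csubspace S" "clinear_on S f" "x \<in> S" "y \<in> S"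
  shows "f (x - y) = f x - f y"
proof -
  have "f (x + (-1) *\<^sub>R y) = f x + (-1) *\<^sub>R f y"
    using assms by (metis clinear_on_add clinear_on_scaleR csubspace_scaleR)
  then show ?thesis by simp
qed

lemma clinear_on_subset: "clinear_on S f \<Longrightarrow> T \<subseteq> S \<Longrightarrow> clinear_on T f"
  unfolding clinear_on_def by blast

lemma clinear_on_UNIV_imp_linear: "clinear_on UNIV f \<Longrightarrow> linear f"
  by (rule linearI) (auto simp: clinear_on_add clinear_on_scaleR)

lemma bounded_ops_imp_bounded_linear:
  assumes "f \<in> bounded_ops UNIV UNIV"
  shows "bounded_linear f"
proof -
  have "linear f" "\<exists>K. \<forall>x. norm (f x) \<le> norm x * K"
    using assms by (auto simp: bounded_ops_def clinear_on_UNIV_imp_linear mult.commute)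
  then show ?thesis
    by (intro bounded_linear.intro bounded_linear_axioms.intro)
qed


section \<open>Riesz representation and orthogonal projection\<close>

text \<open>
  The representing vector minimises \<open>J v = \<parallel>v\<parallel>\<^sup>2 - 2 \<phi> v\<close> over \<open>S\<close>: the parallelogram law gives
  \<open>\<parallel>x - y\<parallel>\<^sup>2 = 2 (J x + J y - 2 J ((x + y) / 2))\<close>, so minimising sequences are Cauchy, and the
  first variation of \<open>J\<close> at the minimiser is the asserted equation.
\<close>

lemma Riesz_real:
  fixes S :: "'a::{real_inner, complete_space} set" and \<phi> :: "'a \<Rightarrow> real"
  assumes S: "subspace S" "closed S"
    and add: "\<And>x y. x \<in> S \<Longrightarrow> y \<in> S \<Longrightarrow> \<phi> (x + y) = \<phi> x + \<phi> y"
    and scale: "\<And>r x. x \<in> S \<Longrightarrow> \<phi> (r *\<^sub>R x) = r * \<phi> x"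
    and bound: "\<And>x. x \<in> S \<Longrightarrow> \<bar>\<phi> x\<bar> \<le> C * norm x"
  shows "\<exists>w\<in>S. \<forall>v\<in>S. \<phi> v = inner w v"
proof -
  define J where "J v = (norm v)\<^sup>2 - 2 * \<phi> v" for v
  define m where "m = Inf (J ` S)"
  have "J v \<ge> - C\<^sup>2" if "v \<in> S" for v
  proof -
    have "0 \<le> (norm v - C)\<^sup>2" by simp
    then show ?thesis
      using bound[OF that] by (simp add: J_def power2_eq_square algebra_simps)
  qed
  then have bdd: "bdd_below (J ` S)"
    by (auto intro!: bdd_belowI2)
  have m: "m \<le> J v" if "v \<in> S" for v
    unfolding m_def using that bdd by (auto intro: cInf_lower)
  have "\<exists>v\<in>S. J v < m + 1 / real (Suc n)" for n
  proof -
    have "J ` S \<noteq> {}" using subspace_0[OF S(1)] by auto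
    then show ?thesis
      using cInf_lessD[of "J ` S" "m + 1 / real (Suc n)"] by (auto simp: m_def)
  qed
  then obtain w where wS: "\<And>n. w n \<in> S" and wJ: "\<And>n. J (w n) < m + 1 / real (Suc n)"
    by metis
  have mid: "(norm (x - y))\<^sup>2 \<le> 2 * ((J x - m) + (J y - m))" if "x \<in> S" "y \<in> S" for x y
  proof -
    have "(1/2) *\<^sub>R (x + y) \<in> S"
      using that S(1) by (simp add: subspace_add subspace_scale)
    then have "m \<le> J ((1/2) *\<^sub>R (x + y))" by (rule m)
    also have "J ((1/2) *\<^sub>R (x + y)) = (norm (x + y))\<^sup>2 / 4 - (\<phi> x + \<phi> y)"
      using that S(1) by (simp add: J_def scale add subspace_add power_divide add_divide_distrib)
    finally show ?thesis
      unfolding J_def by (simp add: power2_norm_eq_inner inner_simps inner_commute field_simps)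
  qed
  have lim0: "(\<lambda>n. 1 / real (Suc n)) \<longlonglongrightarrow> 0"
    using LIMSEQ_inverse_real_of_nat by (simp add: inverse_eq_divide)
  have "Cauchy w"
    unfolding Cauchy_altdef2
  proof (intro allI impI)
    fix e :: real assume "e > 0"
    then obtain N where N: "1 / real (Suc N) < e\<^sup>2 / 4"
      using order_tendstoD(2)[OF lim0, of "e\<^sup>2 / 4"] by (auto simp: eventually_sequentially)
    have "dist (w n) (w N) < e" if "n \<ge> N" for n
    proof -
      have "J (w k) - m < e\<^sup>2 / 4" if "k \<ge> N" for k
      proof -
        have "1 / real (Suc k) \<le> 1 / real (Suc N)"
          using that by (simp add: frac_le)
        then show ?thesis using wJ[of k] N by (simp only: less_diff_eq diff_less_eq)
      qed
      from this[OF that] this[OF order_refl] have "(norm (w n - w N))\<^sup>2 < e\<^sup>2"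
        using mid[OF wS wS, of n N] by argo
      then show ?thesis
        using \<open>e > 0\<close> by (simp add: dist_norm power_less_imp_less_base)
    qed
    then show "\<exists>N. \<forall>n\<ge>N. dist (w n) (w N) < e" by blast
  qed
  then obtain l where l: "w \<longlonglongrightarrow> l"
    using Cauchy_convergent_iff convergent_def by blast
  have lS: "l \<in> S"
    using closed_sequentially[OF S(2)] wS l by blast
  have "(\<lambda>n. \<phi> (w n)) \<longlonglongrightarrow> \<phi> l"
  proof (rule LIM_zero_cancel, rule Lim_null_comparison)
    have "\<phi> (w n) - \<phi> l = \<phi> (w n - l)" for n
      using add[OF wS[of n], of "(-1) *\<^sub>R l"] scale[OF lS, of "-1"] lS S(1)
      by (simp add: subspace_neg)
    then show "\<forall>\<^sub>F n in sequentially. norm (\<phi> (w n) - \<phi> l) \<le> C * norm (w n - l)"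
      using bound wS lS S(1) by (simp add: subspace_diff)
    show "(\<lambda>n. C * norm (w n - l)) \<longlonglongrightarrow> 0"
      using l by (auto intro!: tendsto_eq_intros)
  qed
  then have "(\<lambda>n. J (w n)) \<longlonglongrightarrow> J l"
    unfolding J_def using l by (intro tendsto_intros)
  moreover have "(\<lambda>n. m + 1 / real (Suc n)) \<longlonglongrightarrow> m"
    using tendsto_add[OF tendsto_const lim0, of m] by simp
  ultimately have Jl: "J l \<le> m"
    by (rule LIMSEQ_le) (intro exI allI impI less_imp_le wJ)
  have "\<phi> v = inner l v" if v: "v \<in> S" for v
  proof -
    define d where "d = inner l v - \<phi> v"
    have *: "0 \<le> 2 * t * d + t\<^sup>2 * (norm v)\<^sup>2" for t
    proof -
      have "J l \<le> J (l + t *\<^sub>R v)"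
        using Jl m[of "l + t *\<^sub>R v"] lS v S(1) by (simp add: subspace_add subspace_scale)
      then show ?thesis
        using lS v S(1) unfolding J_def d_def power2_norm_eq_inner
        by (simp add: add scale subspace_scale inner_simps inner_commute algebra_simps
            power2_eq_square)
    qed
    show ?thesis
    proof (cases "v = 0")
      case True
      then show ?thesis using scale[OF subspace_0[OF S(1)], of 0] by simp
    next
      case False
      have "2 * (- d / (norm v)\<^sup>2) * d + (- d / (norm v)\<^sup>2)\<^sup>2 * (norm v)\<^sup>2 = - d\<^sup>2 / (norm v)\<^sup>2"
        using False by (simp add: field_simps power2_eq_square)
      with *[of "- d / (norm v)\<^sup>2"] have "d\<^sup>2 / (norm v)\<^sup>2 \<le> 0"
        by simp
      then have "d = 0"
        using False by (simp add: divide_le_0_iff)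
      then show ?thesis by (simp add: d_def)
    qed
  qed
  with lS show ?thesis by blast
qed

theorem Riesz_representation:
  fixes S :: "'a::chilbert_space set" and \<phi> :: "'a \<Rightarrow> complex"
  assumes S: "csubspace S" "closed S"
    and lin: "clinear_on S \<phi>" and bound: "\<And>x. x \<in> S \<Longrightarrow> cmod (\<phi> x) \<le> C * norm x"
  shows "\<exists>w\<in>S. \<forall>v\<in>S. \<phi> v = cinner w v"
proof -
  have "\<exists>w\<in>S. \<forall>v\<in>S. Re (\<phi> v) = inner w v"
  proof (rule Riesz_real[where C = C])
    show "\<bar>Re (\<phi> x)\<bar> \<le> C * norm x" if "x \<in> S" for x
      using abs_Re_le_cmod[of "\<phi> x"] bound[OF that] by linarith
  qed (use S lin in \<open>auto simp: csubspace_imp_subspace clinear_on_add clinear_on_scaleR\<close>)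
  then obtain w where w: "w \<in> S" "\<And>v. v \<in> S \<Longrightarrow> Re (\<phi> v) = Re (cinner w v)"
    by (auto simp: Re_cinner)
  have "\<phi> v = cinner w v" if "v \<in> S" for v
  proof (rule complex_eqI)
    show "Re (\<phi> v) = Re (cinner w v)" using w that by blast
    \<comment> \<open>complex linearity: the imaginary part at \<open>v\<close> is the real part at \<open>- \<i> v\<close>\<close>
    have "Re (\<phi> ((- \<i>) *\<^sub>C v)) = Re (cinner w ((- \<i>) *\<^sub>C v))"
      using w that S(1) complex_vector.subspace_scale by blast
    then show "Im (\<phi> v) = Im (cinner w v)"
      unfolding clinear_on_scaleC[OF lin that] cinner_scaleC_right scaleC_complex_def by simp
  qed
  with w(1) show ?thesis by blast
qed

lemma eq_if_cinner_eq:
  assumes "csubspace S" "x \<in> S" "y \<in> S" "\<And>s. s \<in> S \<Longrightarrow> cinner x s = cinner y s"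
  shows "x = y"
proof -
  have "cinner (x - y) (x - y) = 0"
    using assms by (simp add: cinner_diff_left complex_vector.subspace_diff)
  then show ?thesis by (simp add: cinner_self)
qed

lemma cinner_clinear_on: "clinear_on S (cinner x)"
  by (simp add: clinear_on_def cinner_simps scaleC_complex_def)

lemma ex1_orth_proj:
  fixes S :: "'a::chilbert_space set"
  assumes S: "csubspace S" "closed S"
  shows "\<exists>!y. y \<in> S \<and> (\<forall>s\<in>S. cinner y s = cinner x s)"
proof -
  obtain y where "y \<in> S" "\<forall>s\<in>S. cinner y s = cinner x s"
    using Riesz_representation[OF S cinner_clinear_on norm_cinner_le, of x] by force
  then show ?thesis
    by (intro ex1I[of _ y]) (auto intro: eq_if_cinner_eq[OF S(1)])
qed

lemma embedding_adjoint_eq_orth_proj: "embedding_adjoint S x = orth_proj S x"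
  unfolding embedding_adjoint_def orth_proj_def
  by (intro arg_cong[where f = The] ext) (auto simp: cinner_diff_left)

lemma
  fixes S :: "'a::chilbert_space set"
  assumes S: "csubspace S" "closed S"
  shows orth_proj_in: "orth_proj S x \<in> S"
    and cinner_orth_proj: "s \<in> S \<Longrightarrow> cinner (orth_proj S x) s = cinner x s"
  using theI'[OF ex1_orth_proj[OF S, of x], folded embedding_adjoint_def]
  by (auto simp: embedding_adjoint_eq_orth_proj)

lemma orth_proj_eqI:
  fixes S :: "'a::chilbert_space set"
  assumes S: "csubspace S" "closed S" and "y \<in> S" "\<And>s. s \<in> S \<Longrightarrow> cinner y s = cinner x s"
  shows "orth_proj S x = y"
  using assms by (intro eq_if_cinner_eq[OF S(1)]) (auto simp: orth_proj_in cinner_orth_proj)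

lemma norm_orth_proj_le:
  fixes S :: "'a::chilbert_space set"
  assumes S: "csubspace S" "closed S"
  shows "norm (orth_proj S x) \<le> norm x"
proof -
  have "cmod (cinner (orth_proj S x) (orth_proj S x)) \<le> norm x * norm (orth_proj S x)"
    by (subst cinner_orth_proj[OF S orth_proj_in[OF S]]) (rule norm_cinner_le)
  then have "norm (orth_proj S x) * norm (orth_proj S x) \<le> norm x * norm (orth_proj S x)"
    unfolding cinner_self norm_of_real by (simp add: power2_eq_square)
  then show ?thesis
    by (metis mult_right_le_imp_le norm_ge_zero order_le_less)
qed

lemma clinear_on_orth_proj:
  fixes S :: "'a::chilbert_space set"
  assumes S: "csubspace S" "closed S"
  shows "clinear_on T (orth_proj S)"
  unfolding clinear_on_def
  by (auto intro!: orth_proj_eqI[OF S] simp: cinner_simps orth_proj_in[OF S] cinner_orth_proj[OF S]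
      complex_vector.subspace_add[OF S(1)] complex_vector.subspace_scale[OF S(1)])


section \<open>Coercive operators\<close>

lemma coercive_norm_le:
  assumes "c > 0" "c * (norm x)\<^sup>2 \<le> Re (cinner y x)"
  shows "norm x \<le> norm y / c"
proof (cases "x = 0")
  case False
  have "c * (norm x)\<^sup>2 \<le> norm y * norm x"
    using assms(2) complex_Re_le_cmod[of "cinner y x"] norm_cinner_le[of y x] by linarith
  then show ?thesis
    using False assms(1) by (simp add: power2_eq_square field_simps)
qed (use assms in simp)

text \<open>
  The Lax--Milgram lemma. For small \<open>t > 0\<close> the map \<open>x \<mapsto> x - t (T x - y)\<close> is a contraction of
  \<open>S\<close>, because \<open>\<parallel>x - t T x\<parallel>\<^sup>2 \<le> (1 - 2 t c + t\<^sup>2 M\<^sup>2) \<parallel>x\<parallel>\<^sup>2\<close>; its fixed point solves \<open>T x = y\<close>.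
\<close>

lemma coercive_surj:
  fixes S :: "'a::chilbert_space set"
  assumes S: "csubspace S" "closed S" and T: "T \<in> bounded_ops S S"
    and c: "c > 0" and coercive: "\<And>x. x \<in> S \<Longrightarrow> Re (cinner (T x) x) \<ge> c * (norm x)\<^sup>2"
    and y: "y \<in> S"
  shows "\<exists>x\<in>S. T x = y"
proof -
  obtain M0 where M0: "\<And>x. x \<in> S \<Longrightarrow> norm (T x) \<le> M0 * norm x"
    using T by (auto simp: bounded_ops_def)
  define M where "M = max M0 c"
  have M: "norm (T x) \<le> M * norm x" if "x \<in> S" for x
    using M0[OF that] mult_right_mono[of M0 M "norm x"] by (simp add: M_def)
  have "M \<ge> c" "M > 0" using c by (auto simp: M_def)
  have TS: "T x \<in> S" if "x \<in> S" for x using T that by (auto simp: bounded_ops_def)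
  have lin: "clinear_on S T" using T by (simp add: bounded_ops_def)
  define t where "t = c / M\<^sup>2"
  define k where "k = sqrt (1 - c\<^sup>2 / M\<^sup>2)"
  have cM: "0 < c\<^sup>2 / M\<^sup>2" "c\<^sup>2 / M\<^sup>2 \<le> 1"
    using \<open>M \<ge> c\<close> c \<open>M > 0\<close> by (auto simp: power_mono)
  define F where "F x = x - t *\<^sub>R (T x - y)" for x
  have "\<exists>!x. x \<in> S \<and> F x = x"
  proof (rule Banach_fix)
    show "complete S" using S(2) by (simp add: complete_eq_closed)
    show "S \<noteq> {}" using y by blast
    show "0 \<le> k" "k < 1" using cM by (auto simp: k_def)
    show "F ` S \<subseteq> S"
      using TS y S(1) by (auto simp: F_def intro!: complex_vector.subspace_diff csubspace_scaleR)
    fix x x' assume x: "x \<in> S" "x' \<in> S"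
    define d where "d = x - x'"
    have d: "d \<in> S" using x S(1) by (simp add: d_def complex_vector.subspace_diff)
    have "F x - F x' = d - t *\<^sub>R T d"
      unfolding d_def clinear_on_diff[OF S(1) lin x] F_def by (simp add: algebra_simps)
    moreover have "(norm (d - t *\<^sub>R T d))\<^sup>2 \<le> (k * norm d)\<^sup>2"
    proof -
      have "(norm (d - t *\<^sub>R T d))\<^sup>2 = (norm d)\<^sup>2 - 2 * t * Re (cinner (T d) d) + t\<^sup>2 * (norm (T d))\<^sup>2"
        unfolding power2_norm_eq_inner Re_cinner
        by (simp add: inner_simps inner_commute power2_eq_square)
      also have "\<dots> \<le> (norm d)\<^sup>2 - 2 * t * (c * (norm d)\<^sup>2) + t\<^sup>2 * (M * norm d)\<^sup>2"
      proof -
        have "t \<ge> 0" using c by (simp add: t_def)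
        then have "2 * t * (c * (norm d)\<^sup>2) \<le> 2 * t * Re (cinner (T d) d)"
          using coercive[OF d] by (simp add: mult_left_mono)
        moreover have "t\<^sup>2 * (norm (T d))\<^sup>2 \<le> t\<^sup>2 * (M * norm d)\<^sup>2"
          using M[OF d] by (intro mult_left_mono power_mono) auto
        ultimately show ?thesis by linarith
      qed
      also have "\<dots> = (1 - c\<^sup>2 / M\<^sup>2) * (norm d)\<^sup>2"
        using \<open>M > 0\<close> by (simp add: t_def field_simps power2_eq_square)
      also have "\<dots> = (k * norm d)\<^sup>2"
        using cM by (simp add: k_def power_mult_distrib)
      finally show ?thesis .
    qed
    ultimately have "norm (F x - F x') \<le> k * norm d"
      using \<open>0 \<le> k\<close> by (metis mult_nonneg_nonneg norm_ge_zero power2_le_imp_le)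
    then show "dist (F x) (F x') \<le> k * dist x x'"
      by (simp add: dist_norm d_def)
  qed
  then obtain x where "x \<in> S" "F x = x" by blast
  moreover have "t \<noteq> 0" using c \<open>M > 0\<close> by (simp add: t_def)
  ultimately show ?thesis by (auto simp: F_def)
qed

lemma cont_invertibleI:
  assumes S: "csubspace S" and T: "T \<in> bounded_ops S S" and surj: "\<And>y. y \<in> S \<Longrightarrow> \<exists>x\<in>S. T x = y"
    and below: "\<And>x. x \<in> S \<Longrightarrow> norm x \<le> K * norm (T x)"
  shows "cont_invertible S T"
proof -
  have TS: "T ` S \<subseteq> S" and lin: "clinear_on S T"
    using T by (auto simp: bounded_ops_def)
  have inj: "inj_on T S"
  proof (rule inj_onI)
    fix x y assume "x \<in> S" "y \<in> S" "T x = T y"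
    then show "x = y"
      using below[of "x - y"] S by (simp add: clinear_on_diff[OF S lin] complex_vector.subspace_diff)
  qed
  have bij: "bij_betw T S S"
    using inj TS surj by (auto simp: bij_betw_def)
  let ?I = "inv_into S T"
  have I: "?I y \<in> S" "T (?I y) = y" if "y \<in> S" for y
    using bij that by (auto simp: bij_betw_def inv_into_into f_inv_into_f)
  have I_eq: "?I y = x" if "x \<in> S" "T x = y" for x y
    using inj that by auto
  have "clinear_on S ?I"
    unfolding clinear_on_def
    by (auto intro!: I_eq simp: clinear_on_add[OF lin] clinear_on_scaleC[OF lin] I
        complex_vector.subspace_add[OF S] complex_vector.subspace_scale[OF S])
  moreover have "norm (?I y) \<le> K * norm y" if "y \<in> S" for y
    using below[OF I(1)] I(2) that by simp
  ultimately show ?thesis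
    using T bij I(1) by (auto simp: cont_invertible_def bounded_ops_def)
qed

theorem Lax_Milgram:
  fixes S :: "'a::chilbert_space set"
  assumes S: "csubspace S" "closed S" and T: "T \<in> bounded_ops S S"
    and c: "c > 0" and coercive: "\<And>x. x \<in> S \<Longrightarrow> Re (cinner (T x) x) \<ge> c * (norm x)\<^sup>2"
  shows "cont_invertible S T"
proof (rule cont_invertibleI[where K = "1 / c"])
  show "norm x \<le> 1 / c * norm (T x)" if "x \<in> S" for x
    using coercive_norm_le[OF c coercive[OF that]] by simp
qed (use coercive_surj[OF S T c coercive] S T in auto)


section \<open>Weak convergence\<close>

lemma cinner_in_normed_dual: "cinner h \<in> normed_dual UNIV norm"
  using norm_cinner_le by (auto simp: normed_dual_def cinner_clinear_on)

lemma weakly_converges_iff: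
  fixes l :: "'a::chilbert_space"
  shows "weakly_converges x l \<longleftrightarrow> (\<forall>h. (\<lambda>n. cinner h (x n)) \<longlonglongrightarrow> cinner h l)"
proof
  assume *: "\<forall>h. (\<lambda>n. cinner h (x n)) \<longlonglongrightarrow> cinner h l"
  have "(\<lambda>n. f (x n)) \<longlonglongrightarrow> f l" if f: "f \<in> normed_dual UNIV norm" for f :: "'a \<Rightarrow> complex"
  proof -
    obtain C where "clinear_on UNIV f" "\<forall>v. cmod (f v) \<le> C * norm v"
      using f by (auto simp: normed_dual_def)
    then obtain w where "\<forall>v. f v = cinner w v"
      using Riesz_representation[of UNIV f C] by auto
    then show ?thesis using * by simp
  qed
  then show "weakly_converges x l"
    by (simp add: weakly_converges_in_def)
qed (auto simp: weakly_converges_in_def cinner_in_normed_dual)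

lemma weakly_convergesD:
  assumes "weakly_converges x (l::'a::chilbert_space)"
  shows "(\<lambda>n. cinner h (x n)) \<longlonglongrightarrow> cinner h l" "(\<lambda>n. cinner (x n) h) \<longlonglongrightarrow> cinner l h"
proof -
  show "(\<lambda>n. cinner h (x n)) \<longlonglongrightarrow> cinner h l"
    using assms by (simp add: weakly_converges_iff)
  from tendsto_cnj[OF this] show "(\<lambda>n. cinner (x n) h) \<longlonglongrightarrow> cinner l h"
    by (simp add: cinner_commute[of _ h])
qed

lemma weakly_converges_const: "weakly_converges (\<lambda>n. c) (c::'a::chilbert_space)"
  by (simp add: weakly_converges_iff)

lemma weakly_converges_unique:
  fixes l :: "'a::chilbert_space"
  assumes "weakly_converges x l" "weakly_converges x l'"
  shows "l = l'"
proof (rule eq_if_cinner_eq[of UNIV])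
  show "cinner l s = cinner l' s" for s
    using LIMSEQ_unique[OF weakly_convergesD(2)[OF assms(1)] weakly_convergesD(2)[OF assms(2)]] .
qed auto

lemma weakly_converges_subseq:
  fixes l :: "'a::chilbert_space"
  shows "weakly_converges x l \<Longrightarrow> strict_mono r \<Longrightarrow> weakly_converges (\<lambda>n. x (r n)) l"
  unfolding weakly_converges_iff using LIMSEQ_subseq_LIMSEQ[unfolded o_def] by blast

lemma weakly_converges_orth_proj:
  fixes S :: "'a::chilbert_space set"
  assumes S: "csubspace S" "closed S" and x: "weakly_converges x l"
  shows "weakly_converges (\<lambda>n. orth_proj S (x n)) (orth_proj S l)"
proof -
  have "cinner h (orth_proj S y) = cinner (orth_proj S h) y" for h y
    by (metis S cinner_commute cinner_orth_proj orth_proj_in)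
  then show ?thesis
    using weakly_convergesD(1)[OF x] by (simp add: weakly_converges_iff)
qed

lemma weak_limit_in:
  fixes S :: "'a::chilbert_space set"
  assumes S: "csubspace S" "closed S" and "weakly_converges x l" "\<And>n. x n \<in> S"
  shows "l \<in> S"
proof -
  have "orth_proj S (x n) = x n" for n
    using assms by (intro orth_proj_eqI) auto
  then have "l = orth_proj S l"
    using weakly_converges_orth_proj[OF S assms(3)] assms(3) weakly_converges_unique by auto
  then show ?thesis
    using orth_proj_in[OF S] by metis
qed

text \<open>
  Weak lower semicontinuity of the norm, in the form in which it transports coercivity bounds
  to a limit. The reason is that \<open>\<parallel>x n\<parallel>\<^sup>2 \<ge> 2 Re \<langle>l, x n\<rangle> - \<parallel>l\<parallel>\<^sup>2\<close>, whose right-hand side converges.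
\<close>

lemma weak_limit_norm_le:
  fixes l :: "'a::chilbert_space"
  assumes x: "weakly_converges x l" and "\<gamma> \<ge> 0" and s: "s \<longlonglongrightarrow> s0"
    and le: "\<And>n. \<gamma> * (norm (x n))\<^sup>2 \<le> s n"
  shows "\<gamma> * (norm l)\<^sup>2 \<le> s0"
proof -
  have "(\<lambda>n. \<gamma> * (2 * Re (cinner l (x n)) - (norm l)\<^sup>2)) \<longlonglongrightarrow> \<gamma> * (2 * Re (cinner l l) - (norm l)\<^sup>2)"
    by (intro tendsto_intros weakly_convergesD x)
  then have "(\<lambda>n. \<gamma> * (2 * Re (cinner l (x n)) - (norm l)\<^sup>2)) \<longlonglongrightarrow> \<gamma> * (norm l)\<^sup>2"
    by (simp add: cinner_self)
  moreover have "\<gamma> * (2 * Re (cinner l (x n)) - (norm l)\<^sup>2) \<le> s n" for n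
  proof -
    have "0 \<le> (norm (x n - l))\<^sup>2" by simp
    then have "2 * Re (cinner l (x n)) - (norm l)\<^sup>2 \<le> (norm (x n))\<^sup>2"
      by (simp add: power2_norm_eq_inner inner_simps Re_cinner inner_commute)
    then show ?thesis
      using le[of n] \<open>\<gamma> \<ge> 0\<close> mult_left_mono by fastforce
  qed
  ultimately show ?thesis
    using s LIMSEQ_le by blast
qed

lemma LIMSEQ_if_subsubseq:
  fixes x :: "nat \<Rightarrow> 'a::metric_space"
  assumes "\<And>r::nat \<Rightarrow> nat. strict_mono r \<Longrightarrow> \<exists>s. strict_mono s \<and> (\<lambda>n. x (r (s n))) \<longlonglongrightarrow> l"
  shows "x \<longlonglongrightarrow> l"
proof (rule ccontr)
  assume "\<not> x \<longlonglongrightarrow> l"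
  then obtain e where e: "e > 0" "\<forall>N. \<exists>n\<ge>N. \<not> dist (x n) l < e"
    by (auto simp: lim_sequentially)
  then have "infinite {n. \<not> dist (x n) l < e}"
    by (auto simp: infinite_nat_iff_unbounded_le)
  then obtain r :: "nat \<Rightarrow> nat" where r: "strict_mono r" "\<And>n. \<not> dist (x (r n)) l < e"
    using infinite_enumerate[of "{n. \<not> dist (x n) l < e}"] by auto
  then show False
    using assms[OF r(1)] e(1) by (auto simp: lim_sequentially)
qed

lemma weakly_converges_if_subsubseq:
  fixes l :: "'a::chilbert_space"
  assumes "\<And>r::nat \<Rightarrow> nat. strict_mono r \<Longrightarrow> \<exists>s. strict_mono s \<and> weakly_converges (\<lambda>n. x (r (s n))) l"
  shows "weakly_converges x l"
  unfolding weakly_converges_iff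
proof
  fix h
  show "(\<lambda>n. cinner h (x n)) \<longlonglongrightarrow> cinner h l"
    by (rule LIMSEQ_if_subsubseq) (use assms weakly_convergesD(1) in blast)
qed

text \<open>Uniform boundedness lets strong convergence of the arguments pass through weak convergence.\<close>

lemma weakly_converges_apply:
  fixes T :: "nat \<Rightarrow> 'a::chilbert_space \<Rightarrow> 'b::chilbert_space"
  assumes lin: "\<And>n. linear (T n)" and bound: "\<And>n x. norm (T n x) \<le> K * norm x"
    and weak: "weakly_converges (\<lambda>n. T n x) y" and strong: "\<xi> \<longlonglongrightarrow> x"
  shows "weakly_converges (\<lambda>n. T n (\<xi> n)) y"
  unfolding weakly_converges_iff
proof
  fix h
  have "(\<lambda>n. cinner h (T n (\<xi> n - x))) \<longlonglongrightarrow> 0"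
  proof (rule Lim_null_comparison)
    show "\<forall>\<^sub>F n in sequentially. norm (cinner h (T n (\<xi> n - x))) \<le> norm h * (K * norm (\<xi> n - x))"
      by (rule always_eventually)
        (meson bound mult_left_mono norm_cinner_le norm_ge_zero order_trans)
    show "(\<lambda>n. norm h * (K * norm (\<xi> n - x))) \<longlonglongrightarrow> 0"
      using strong by (auto intro!: tendsto_eq_intros)
  qed
  from tendsto_add[OF this weakly_convergesD(1)[OF weak, of h]]
  show "(\<lambda>n. cinner h (T n (\<xi> n))) \<longlonglongrightarrow> cinner h y"
    by (simp add: linear_diff[OF lin] cinner_diff_right)
qed


section \<open>Sequential compactness for the weak operator topology\<close>

lemma convergent_if_convergent_on_dense:
  fixes \<phi> :: "nat \<Rightarrow> 'a::real_normed_vector \<Rightarrow> complex"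
  assumes diff: "\<And>n x y. \<phi> n (x - y) = \<phi> n x - \<phi> n y"
    and bound: "\<And>n x. cmod (\<phi> n x) \<le> M * norm x"
    and D: "closure D = UNIV" and conv: "\<And>x. x \<in> D \<Longrightarrow> convergent (\<lambda>n. \<phi> n x)"
  shows "convergent (\<lambda>n. \<phi> n x)"
proof -
  define K where "K = \<bar>M\<bar> + 1"
  have "K > 0" by (simp add: K_def)
  have K: "cmod (\<phi> n x) \<le> K * norm x" for n x
    using bound[of n x] mult_right_mono[of M K "norm x"] unfolding K_def by force
  have "Cauchy (\<lambda>n. \<phi> n x)"
    unfolding Cauchy_def
  proof (intro allI impI)
    fix e :: real assume "e > 0"
    then have "0 < e / (3 * K)" using \<open>K > 0\<close> by simp
    then obtain x' where x': "x' \<in> D" "dist x' x < e / (3 * K)"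
      using D closure_approachable[of x D] by blast
    have near: "dist (\<phi> n x) (\<phi> n x') < e / 3" for n
    proof -
      have "dist (\<phi> n x) (\<phi> n x') \<le> K * norm (x - x')"
        using K[of n "x - x'"] by (simp add: diff dist_norm)
      also have "\<dots> < e / 3"
        using x'(2) \<open>K > 0\<close> by (simp add: dist_norm norm_minus_commute field_simps)
      finally show ?thesis .
    qed
    obtain N where N: "\<And>m n. m \<ge> N \<Longrightarrow> n \<ge> N \<Longrightarrow> dist (\<phi> m x') (\<phi> n x') < e / 3"
      using metric_CauchyD[OF convergent_Cauchy[OF conv[OF x'(1)]], of "e / 3"] \<open>e > 0\<close> by auto
    have "dist (\<phi> m x) (\<phi> n x) < e" if "m \<ge> N" "n \<ge> N" for m n
      using near[of m] near[of n] N[OF that] dist_triangle[of "\<phi> m x" "\<phi> n x" "\<phi> m x'"]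
        dist_triangle[of "\<phi> m x'" "\<phi> n x" "\<phi> n x'"]
      by (simp add: dist_commute)
    then show "\<exists>N. \<forall>m\<ge>N. \<forall>n\<ge>N. dist (\<phi> m x) (\<phi> n x) < e" by blast
  qed
  then show ?thesis by (rule Cauchy_convergent)
qed

text \<open>
  A diagonal sequence makes the countably many scalar sequences \<open>\<langle>T n x, y\<rangle>\<close> with \<open>x\<close>, \<open>y\<close> in a
  countable dense set converge; uniform boundedness extends this to all \<open>x\<close>, \<open>y\<close>, and the limit
  form is represented by an operator.
\<close>

theorem weak_operator_compactness:
  fixes T :: "nat \<Rightarrow> 'a::chilbert_space \<Rightarrow> 'a"
  assumes sep: "separable_space (euclidean :: 'a topology)"
    and lin: "\<And>n. clinear_on UNIV (T n)" and bound: "\<And>n x. norm (T n x) \<le> K * norm x"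
  shows "\<exists>r S. strict_mono (r::nat \<Rightarrow> nat) \<and> S \<in> bounded_ops UNIV UNIV \<and>
           (\<forall>x. norm (S x) \<le> K * norm x) \<and> (\<forall>x. weakly_converges (\<lambda>n. T (r n) x) (S x))"
proof -
  obtain D :: "'a set" where D: "countable D" "closure D = UNIV"
    using sep by (auto simp: separable_space_def)
  have le: "cmod (cinner (T n x) y) \<le> K * norm x * norm y" for n x y
    by (meson norm_cinner_le bound mult_right_mono norm_ge_zero order_trans)
  define f where "f n p = cinner (T n (fst p)) (snd p) / (norm (fst p) * norm (snd p))" for n p
  have f: "norm (f n p) \<le> \<bar>K\<bar>" for n p
  proof (cases "norm (fst p) * norm (snd p) = 0")
    case False
    then have "0 < norm (fst p) * norm (snd p)" by simp
    moreover have "cmod (cinner (T n (fst p)) (snd p)) \<le> \<bar>K\<bar> * (norm (fst p) * norm (snd p))"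
      using le[of n "fst p" "snd p"] mult_right_mono[OF abs_ge_self[of K], of "norm (fst p) * norm (snd p)"]
      by (simp add: mult.assoc)
    ultimately show ?thesis
      by (simp add: f_def norm_divide norm_mult pos_divide_le_eq)
  qed (auto simp: f_def)
  obtain r where r: "strict_mono (r::nat \<Rightarrow> nat)"
    and rf: "\<And>p. p \<in> D \<times> D \<Longrightarrow> \<exists>l. (\<lambda>n. f (r n) p) \<longlonglongrightarrow> l"
    by (rule function_convergent_subsequence[of "D \<times> D" f "\<bar>K\<bar>"]) (use D(1) f in auto)
  have conv_DD: "convergent (\<lambda>n. cinner (T (r n) x) y)" if xy: "x \<in> D" "y \<in> D" for x y
  proof -
    have eq: "(\<lambda>n. cinner (T (r n) x) y) = (\<lambda>n. f (r n) (x, y) * (norm x * norm y))"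
    proof
      fix n
      show "cinner (T (r n) x) y = f (r n) (x, y) * (norm x * norm y)"
        using le[of "r n" x y] by (cases "norm x * norm y = 0") (auto simp: f_def)
    qed
    obtain l where "(\<lambda>n. f (r n) (x, y)) \<longlonglongrightarrow> l" using rf[of "(x, y)"] xy by auto
    then show ?thesis
      unfolding eq convergent_def by (auto intro: tendsto_mult_right)
  qed
  have conv_D: "convergent (\<lambda>n. cinner (T (r n) x) y)" if "x \<in> D" for x y
    by (rule convergent_if_convergent_on_dense[where D = D and M = "K * norm x"])
      (use le D(2) conv_DD that in \<open>auto simp: cinner_simps mult.assoc\<close>)
  have conv: "convergent (\<lambda>n. cinner (T (r n) x) y)" for x y
    by (rule convergent_if_convergent_on_dense[where D = D and M = "K * norm y"])
      (use le D(2) conv_D in \<open>auto simp: cinner_simps mult.commute mult.left_commute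
         linear_diff[OF clinear_on_UNIV_imp_linear[OF lin]]\<close>)
  define L where "L x y = lim (\<lambda>n. cinner (T (r n) x) y)" for x y
  have L: "(\<lambda>n. cinner (T (r n) x) y) \<longlonglongrightarrow> L x y" for x y
    using conv by (simp add: L_def convergent_LIMSEQ_iff)
  have "\<exists>w\<in>UNIV. \<forall>v\<in>UNIV. L x v = cinner w v" for x
  proof (rule Riesz_representation[where C = "K * norm x"])
    show "clinear_on UNIV (L x)"
      unfolding clinear_on_def
    proof (intro conjI ballI allI)
      fix y z c
      show "L x (y + z) = L x y + L x z"
        using LIMSEQ_unique[OF L tendsto_add[OF L L, of x y x z, folded cinner_add_right]] .
      show "L x (c *\<^sub>C y) = c *\<^sub>C L x y"
        using LIMSEQ_unique[OF L[of x "c *\<^sub>C y"]] tendsto_mult_left[OF L, of c x y]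
        by (simp add: cinner_scaleC_right scaleC_complex_def)
    qed
    show "cmod (L x y) \<le> K * norm x * norm y" for y
      by (rule Lim_norm_ubound[OF _ L]) (auto simp: le)
  qed auto
  then obtain S where S: "\<And>x y. L x y = cinner (S x) y"
    by (metis UNIV_I)
  have weak: "weakly_converges (\<lambda>n. T (r n) x) (S x)" for x
    unfolding weakly_converges_iff
  proof
    fix h
    from tendsto_cnj[OF L[of x h, unfolded S]]
    show "(\<lambda>n. cinner h (T (r n) x)) \<longlonglongrightarrow> cinner h (S x)"
      by (simp add: cinner_commute[of h])
  qed
  have add: "S (x + y) = S x + S y" and scale: "S (c *\<^sub>C x) = c *\<^sub>C S x" for x y c
  proof -
    have "weakly_converges (\<lambda>n. T (r n) (x + y)) (S x + S y)"
      using weakly_convergesD(1)[OF weak]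
      by (simp add: weakly_converges_iff clinear_on_add[OF lin] cinner_simps tendsto_add)
    then show "S (x + y) = S x + S y" using weakly_converges_unique[OF weak] by auto
    have "weakly_converges (\<lambda>n. T (r n) (c *\<^sub>C x)) (c *\<^sub>C S x)"
      using weakly_convergesD(1)[OF weak]
      by (simp add: weakly_converges_iff clinear_on_scaleC[OF lin] cinner_simps tendsto_mult_left)
    then show "S (c *\<^sub>C x) = c *\<^sub>C S x" using weakly_converges_unique[OF weak] by auto
  qed
  have S_le: "norm (S x) \<le> K * norm x" for x
  proof (cases "S x = 0")
    case True
    then show ?thesis using order_trans[OF norm_ge_zero bound[of 0 x]] by simp
  next
    case False
    have "cmod (cinner (S x) (S x)) \<le> K * norm x * norm (S x)"
      by (rule Lim_norm_ubound[OF _ L[unfolded S]]) (auto simp: le)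
    then show ?thesis
      using False by (simp add: cinner_self power2_eq_square norm_mult)
  qed
  have "S \<in> bounded_ops UNIV UNIV"
    using add scale S_le by (auto simp: bounded_ops_def clinear_on_def)
  then show ?thesis using r weak S_le by blast
qed

section \<open>Mixed inversion in an orthogonal decomposition\<close>

lemma block_bounded_ops:
  fixes S :: "'a::chilbert_space set"
  assumes S: "csubspace S" "closed S" and T: "T \<in> bounded_ops UNIV UNIV"
  shows "block S S T \<in> bounded_ops S S"
proof -
  obtain C where C: "\<And>x. norm (T x) \<le> C * norm x" and lin: "clinear_on UNIV T"
    using T by (auto simp: bounded_ops_def)
  have B: "block S S T x = orth_proj S (T x)" if "x \<in> S" for x
    using that by (simp add: block_def embedding_adjoint_eq_orth_proj)
  have "clinear_on S (block S S T)"
    unfolding clinear_on_def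
    using clinear_on_orth_proj[OF S, of UNIV] lin
    by (simp add: B clinear_on_add clinear_on_scaleC complex_vector.subspace_add[OF S(1)]
        complex_vector.subspace_scale[OF S(1)])
  moreover have "norm (block S S T x) \<le> C * norm x" if "x \<in> S" for x
    using B[OF that] norm_orth_proj_le[OF S, of "T x"] C[of x] by simp
  ultimately show ?thesis
    using orth_proj_in[OF S] by (auto simp: bounded_ops_def B)
qed

text \<open>
  The substitution \<open>y = (\<iota>\<^sup>* T \<iota>) x\<close> turns a lower bound for the inverse of the compression into
  one in which no inverse occurs; invertibility is the Lax--Milgram lemma.
\<close>

lemma block_bounds_iff:
  fixes S :: "'a::chilbert_space set"
  assumes S: "csubspace S" "closed S" and T: "T \<in> bounded_ops UNIV UNIV" and "c > 0"
  shows "cont_invertible S (block S S T) \<and> Re_ge S (block S S T) c \<and>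
           Re_ge S (inv_into S (block S S T)) d \<longleftrightarrow>
         (\<forall>x\<in>S. c * (norm x)\<^sup>2 \<le> Re (cinner (T x) x) \<and>
                d * (norm (orth_proj S (T x)))\<^sup>2 \<le> Re (cinner (T x) x))"
    (is "_ \<longleftrightarrow> ?R")
proof -
  let ?B = "block S S T"
  have B: "?B x = orth_proj S (T x)" and BT: "cinner (?B x) x = cinner (T x) x" if "x \<in> S" for x
    using that by (simp_all add: block_def embedding_adjoint_eq_orth_proj cinner_orth_proj[OF S])
  have ge: "Re_ge S ?B c \<longleftrightarrow> (\<forall>x\<in>S. c * (norm x)\<^sup>2 \<le> Re (cinner (T x) x))"
    by (simp add: Re_ge_def BT)
  have inv: "Re_ge S (inv_into S ?B) d \<longleftrightarrow>
      (\<forall>x\<in>S. d * (norm (orth_proj S (T x)))\<^sup>2 \<le> Re (cinner (T x) x))"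
    if "cont_invertible S ?B"
  proof -
    have bij: "bij_betw ?B S S" using that by (simp add: cont_invertible_def)
    have "Re_ge S (inv_into S ?B) d \<longleftrightarrow> (\<forall>y\<in>?B ` S. d * (norm y)\<^sup>2 \<le> Re (cinner (inv_into S ?B y) y))"
      using bij by (simp add: Re_ge_def bij_betw_def)
    also have "\<dots> \<longleftrightarrow> (\<forall>x\<in>S. d * (norm (?B x))\<^sup>2 \<le> Re (cinner x (?B x)))"
      using bij_betw_imp_inj_on[OF bij] by (simp only: ball_simps) (simp cong: ball_cong)
    also have "\<dots> \<longleftrightarrow> (\<forall>x\<in>S. d * (norm (orth_proj S (T x)))\<^sup>2 \<le> Re (cinner (T x) x))"
      by (intro ball_cong refl) (simp add: Re_cinner_commute[of _ "?B _"] BT, simp add: B)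
    finally show ?thesis .
  qed
  show ?thesis
  proof
    assume R: ?R
    have "cont_invertible S ?B"
      using R by (intro Lax_Milgram[OF S block_bounded_ops[OF S T] \<open>c > 0\<close>]) (simp add: BT)
    with R ge inv show "cont_invertible S ?B \<and> Re_ge S ?B c \<and> Re_ge S (inv_into S ?B) d" by blast
  qed (use ge inv in blast)
qed

locale orthogonal_pair =
  fixes R0 R1 :: "'h::chilbert_space set"
  assumes csub0: "csubspace R0" and closed0: "closed R0"
    and R1_eq: "R1 = {y. \<forall>x\<in>R0. cinner y x = 0}"
begin

abbreviation P0 :: "'h \<Rightarrow> 'h" where "P0 \<equiv> orth_proj R0"
abbreviation P1 :: "'h \<Rightarrow> 'h" where "P1 \<equiv> orth_proj R1"

lemma csub1: "csubspace R1"
  by (auto simp: R1_eq complex_vector.subspace_def cinner_simps)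

lemma closed1: "closed R1"
proof -
  have "R1 = (\<Inter>x\<in>R0. {y. cinner y x = 0})"
    by (auto simp: R1_eq)
  moreover have "closed {y. cinner y x = 0}" for x :: 'h
    unfolding closed_sequential_limits
  proof clarify
    fix f l assume "\<forall>n. f n \<in> {y. cinner y x = 0}" and l: "f \<longlonglongrightarrow> l"
    then have "(\<lambda>n. cinner (f n) x) = (\<lambda>n. 0)" by auto
    with tendsto_cinner[OF l tendsto_const, of x] show "cinner l x = 0"
      using LIMSEQ_unique tendsto_const by metis
  qed
  ultimately show ?thesis by auto
qed

lemmas proj0 = csub0 closed0 and proj1 = csub1 closed1

lemma orth: "x \<in> R0 \<Longrightarrow> y \<in> R1 \<Longrightarrow> cinner x y = 0" "x \<in> R0 \<Longrightarrow> y \<in> R1 \<Longrightarrow> cinner y x = 0"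
  by (simp_all add: R1_eq) (metis cinner_commute complex_cnj_zero)

lemma P_in [simp]: "P0 x \<in> R0" "P1 x \<in> R1"
  by (simp_all add: orth_proj_in proj0 proj1)

lemma P_fixes [simp]: "x \<in> R0 \<Longrightarrow> P0 x = x" "x \<in> R1 \<Longrightarrow> P1 x = x"
  by (auto intro: orth_proj_eqI proj0 proj1)

lemma P_kills [simp]: "x \<in> R1 \<Longrightarrow> P0 x = 0" "x \<in> R0 \<Longrightarrow> P1 x = 0"
  by (auto intro!: orth_proj_eqI proj0 proj1 complex_vector.subspace_0 simp: orth)

lemma P_add [simp]: "P0 (x + y) = P0 x + P0 y" "P1 (x + y) = P1 x + P1 y"
  using clinear_on_add[OF clinear_on_orth_proj[OF proj0, of UNIV]]
    clinear_on_add[OF clinear_on_orth_proj[OF proj1, of UNIV]] by auto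

lemma P_diff [simp]: "P0 (x - y) = P0 x - P0 y" "P1 (x - y) = P1 x - P1 y"
  using clinear_on_diff[OF _ clinear_on_orth_proj[OF proj0, of UNIV]]
    clinear_on_diff[OF _ clinear_on_orth_proj[OF proj1, of UNIV]] by auto

lemma P_scaleC [simp]: "P0 (c *\<^sub>C x) = c *\<^sub>C P0 x" "P1 (c *\<^sub>C x) = c *\<^sub>C P1 x"
  using clinear_on_scaleC[OF clinear_on_orth_proj[OF proj0, of UNIV]]
    clinear_on_scaleC[OF clinear_on_orth_proj[OF proj1, of UNIV]] by auto

lemma P_zero [simp]: "P0 0 = 0" "P1 0 = 0"
  by (simp_all add: P_kills complex_vector.subspace_0 csub0 csub1)

lemma P_norm: "norm (P0 x) \<le> norm x" "norm (P1 x) \<le> norm x"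
  by (simp_all add: norm_orth_proj_le proj0 proj1)

lemma P_sum: "P0 x + P1 x = x"
proof -
  have "x - P0 x \<in> R1"
    by (simp add: R1_eq cinner_simps cinner_orth_proj[OF proj0])
  from P_fixes(2)[OF this] show ?thesis by (simp add: algebra_simps)
qed

lemma in_R: "P1 x = 0 \<Longrightarrow> x \<in> R0" "P0 x = 0 \<Longrightarrow> x \<in> R1"
  using P_sum[of x] P_in[of x] by auto

lemma P_eqI: "P0 x = P0 y \<Longrightarrow> P1 x = P1 y \<Longrightarrow> x = y"
  by (metis P_sum)

text \<open>
  \<open>a\<close> maps \<open>q\<close> to \<open>r = a q\<close>; \<open>mixed a\<close> collects the component of the output \<open>r\<close> in \<open>R0\<close> and the
  component of the input \<open>q\<close> in \<open>R1\<close>. These are the quantities that H-convergence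
  prescribes, while \<open>q\<close> and \<open>r\<close> are recovered from them through \<open>mixed_inv a\<close>.
\<close>

definition mixed :: "('h \<Rightarrow> 'h) \<Rightarrow> 'h \<Rightarrow> 'h" where
  "mixed a q = P0 (a q) + P1 q"

definition mixed_inv :: "('h \<Rightarrow> 'h) \<Rightarrow> 'h \<Rightarrow> 'h" where
  "mixed_inv a = inv (mixed a)"

lemma P_mixed [simp]: "P0 (mixed a q) = P0 (a q)" "P1 (mixed a q) = P1 q"
  by (simp_all add: mixed_def)

lemma mixed_eq_iff: "mixed a q = x \<longleftrightarrow> P0 (a q) = P0 x \<and> P1 q = P1 x"
  by (metis P_eqI P_mixed)

lemma mixed_bounded_ops:
  assumes "a \<in> bounded_ops UNIV UNIV"
  shows "mixed a \<in> bounded_ops UNIV UNIV"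
proof -
  obtain C where C: "\<And>x. norm (a x) \<le> C * norm x" and lin: "clinear_on UNIV a"
    using assms by (auto simp: bounded_ops_def)
  have "clinear_on UNIV (mixed a)"
    using lin by (simp add: clinear_on_def mixed_def scaleC_add_right)
  moreover have "norm (mixed a x) \<le> (C + 1) * norm x" for x
    using norm_triangle_ineq[of "P0 (a x)" "P1 x"] P_norm(1)[of "a x"] P_norm(2)[of x] C[of x]
    by (simp add: mixed_def distrib_right)
  ultimately show ?thesis by (auto simp: bounded_ops_def)
qed

text \<open>
  Writing \<open>q = w + p\<close> with \<open>w \<in> R0\<close> and \<open>p = P1 x\<close>, the equation \<open>mixed a q = x\<close> becomes
  \<open>P0 (a w) = P0 x - P0 (a p)\<close>, so only the coercivity of the compression of \<open>a\<close> to \<open>R0\<close> matters.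
\<close>

lemma mixed_cont_invertible:
  assumes a: "a \<in> bounded_ops UNIV UNIV" and "\<alpha> > 0"
    and coercive: "\<And>q. q \<in> R0 \<Longrightarrow> \<alpha> * (norm q)\<^sup>2 \<le> Re (cinner (a q) q)"
    and C: "\<And>x. norm (a x) \<le> C * norm x"
  shows "cont_invertible UNIV (mixed a)"
    and "norm q \<le> ((1 + C) / \<alpha> + 1) * norm (mixed a q)"
proof -
  have lin: "clinear_on UNIV a" using a by (simp add: bounded_ops_def)
  have below: "norm q \<le> ((1 + C) / \<alpha> + 1) * norm (mixed a q)" for q
  proof -
    define x where "x = mixed a q"
    have p: "norm (P1 q) \<le> norm x" using P_norm(2)[of x] by (simp add: x_def)
    have "a q = a (P0 q) + a (P1 q)"
      using clinear_on_add[OF lin, of "P0 q" "P1 q"] by (simp add: P_sum)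
    then have eq: "P0 (a (P0 q)) = P0 x - P0 (a (P1 q))"
      by (simp add: x_def)
    have "C * norm (P1 q) \<le> C * norm x"
    proof (cases "C \<ge> 0")
      case False
      then have zero: "y = 0" for y :: 'h
        using order_trans[OF norm_ge_zero C[of y]] by (simp add: zero_le_mult_iff)
      show ?thesis using zero[of "P1 q"] zero[of x] by simp
    qed (use p in \<open>simp add: mult_left_mono\<close>)
    then have "norm (P0 (a (P0 q))) \<le> (1 + C) * norm x"
      unfolding eq using norm_triangle_ineq4[of "P0 x" "P0 (a (P1 q))"] P_norm(1)[of x]
        P_norm(1)[of "a (P1 q)"] C[of "P1 q"]
      by (simp add: distrib_right)
    moreover have "norm (P0 q) \<le> norm (P0 (a (P0 q))) / \<alpha>"
      using coercive[of "P0 q"] \<open>\<alpha> > 0\<close>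
      by (intro coercive_norm_le) (simp_all add: cinner_orth_proj[OF proj0])
    ultimately have "norm (P0 q) \<le> (1 + C) / \<alpha> * norm x"
      using \<open>\<alpha> > 0\<close> by (simp add: field_simps)
    with p norm_triangle_ineq[of "P0 q" "P1 q"] show ?thesis
      by (simp add: P_sum x_def distrib_right)
  qed
  then show "norm q \<le> ((1 + C) / \<alpha> + 1) * norm (mixed a q)" .
  have surj: "\<exists>q. mixed a q = x" for x
  proof -
    have "cont_invertible R0 (block R0 R0 a)"
      using coercive by (intro Lax_Milgram[OF proj0 block_bounded_ops[OF proj0 a] \<open>\<alpha> > 0\<close>])
        (simp add: block_def embedding_adjoint_eq_orth_proj cinner_orth_proj[OF proj0])
    moreover have "P0 x - P0 (a (P1 x)) \<in> R0"
      by (simp add: complex_vector.subspace_diff[OF csub0])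
    ultimately have "P0 x - P0 (a (P1 x)) \<in> block R0 R0 a ` R0"
      by (simp add: cont_invertible_def bij_betw_def)
    then obtain w where w: "w \<in> R0" "P0 (a w) = P0 x - P0 (a (P1 x))"
      by (auto simp: block_def embedding_adjoint_eq_orth_proj)
    then have "mixed a (w + P1 x) = x"
      by (simp add: mixed_eq_iff clinear_on_add[OF lin])
    then show ?thesis by blast
  qed
  show "cont_invertible UNIV (mixed a)"
    using below surj mixed_bounded_ops[OF a] by (intro cont_invertibleI) auto
qed

lemma
  assumes "cont_invertible UNIV (mixed a)"
  shows mixed_mixed_inv: "mixed a (mixed_inv a x) = x"
    and mixed_inv_mixed: "mixed_inv a (mixed a q) = q"
    and mixed_inv_clinear: "clinear_on UNIV (mixed_inv a)"
proof -
  have "bij (mixed a)" "inv (mixed a) \<in> bounded_ops UNIV UNIV"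
    using assms by (simp_all add: cont_invertible_def)
  then show "mixed a (mixed_inv a x) = x" "mixed_inv a (mixed a q) = q"
    "clinear_on UNIV (mixed_inv a)"
    unfolding mixed_inv_def
    by (simp_all add: surj_f_inv_f bij_is_surj bij_is_inj bounded_ops_def)
qed

lemma mixed_inv_eqI:
  "cont_invertible UNIV (mixed a) \<Longrightarrow> P0 (a q) = P0 x \<Longrightarrow> P1 q = P1 x \<Longrightarrow> mixed_inv a x = q"
  using mixed_inv_mixed[of a q] mixed_eq_iff[of a q x] by simp

lemma P_mixed_inv:
  assumes "cont_invertible UNIV (mixed a)"
  shows "P0 (a (mixed_inv a x)) = P0 x" "P1 (mixed_inv a x) = P1 x"
  using mixed_mixed_inv[OF assms, of x] unfolding mixed_eq_iff by auto

text \<open>The class \<open>M_class\<close> for an arbitrary orthogonal pair in place of the two ranges.\<close>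

definition M :: "real \<Rightarrow> real \<Rightarrow> ('h \<Rightarrow> 'h) set" where
  "M \<alpha> \<beta> =
     {a. let a00 = block R0 R0 a; ai11 = block R1 R1 (inv a)
         in cont_invertible UNIV a \<and> cont_invertible R0 a00 \<and> cont_invertible R1 ai11 \<and>
            Re_ge R0 a00 \<alpha> \<and> Re_ge R0 (inv_into R0 a00) (1 / \<beta>) \<and>
            Re_ge R1 ai11 (1 / \<beta>) \<and> Re_ge R1 (inv_into R1 ai11) \<alpha>}"

text \<open>
  In terms of pairs \<open>(q, a q)\<close> the four bounds become two pairs of inequalities for one real
  number each, the second by the substitution \<open>z = a q\<close>; this is the form that passes to weak
  limits.
\<close>

lemma M_iff:
  assumes "\<alpha> > 0" "\<beta> > 0"
  shows "a \<in> M \<alpha> \<beta> \<longleftrightarrow> cont_invertible UNIV a \<and>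
    (\<forall>q\<in>R0. \<alpha> * (norm q)\<^sup>2 \<le> Re (cinner (a q) q) \<and>
            1 / \<beta> * (norm (P0 (a q)))\<^sup>2 \<le> Re (cinner (a q) q)) \<and>
    (\<forall>q. a q \<in> R1 \<longrightarrow> 1 / \<beta> * (norm (a q))\<^sup>2 \<le> Re (cinner q (a q)) \<and>
                      \<alpha> * (norm (P1 q))\<^sup>2 \<le> Re (cinner q (a q)))"
    (is "_ \<longleftrightarrow> _ \<and> ?A \<and> ?B")
proof (cases "cont_invertible UNIV a")
  case True
  then have a: "a \<in> bounded_ops UNIV UNIV" "inv a \<in> bounded_ops UNIV UNIV" and "bij a"
    by (auto simp: cont_invertible_def)
  have "?B \<longleftrightarrow> (\<forall>z\<in>R1. 1 / \<beta> * (norm z)\<^sup>2 \<le> Re (cinner (inv a z) z) \<and>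
                      \<alpha> * (norm (P1 (inv a z)))\<^sup>2 \<le> Re (cinner (inv a z) z))"
    using \<open>bij a\<close> by (metis bij_inv_eq_iff)
  then show ?thesis
    using True block_bounds_iff[OF proj0 a(1) \<open>\<alpha> > 0\<close>, of "1 / \<beta>"]
      block_bounds_iff[OF proj1 a(2), of "1 / \<beta>" \<alpha>] \<open>\<beta> > 0\<close>
    unfolding M_def Let_def by simp blast
qed (simp add: M_def Let_def)

lemma M_D:
  assumes "a \<in> M \<alpha> \<beta>" "\<alpha> > 0" "\<beta> > 0"
  shows "cont_invertible UNIV a" "a \<in> bounded_ops UNIV UNIV" "cont_invertible UNIV (mixed a)"
    and "q \<in> R0 \<Longrightarrow> \<alpha> * (norm q)\<^sup>2 \<le> Re (cinner (a q) q)"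
    and "q \<in> R0 \<Longrightarrow> 1 / \<beta> * (norm (P0 (a q)))\<^sup>2 \<le> Re (cinner (a q) q)"
    and "a q \<in> R1 \<Longrightarrow> 1 / \<beta> * (norm (a q))\<^sup>2 \<le> Re (cinner q (a q))"
    and "a q \<in> R1 \<Longrightarrow> \<alpha> * (norm (P1 q))\<^sup>2 \<le> Re (cinner q (a q))"
proof -
  note * = assms(1)[unfolded M_iff[OF assms(2,3)]]
  show "cont_invertible UNIV a" using * by blast
  then show a: "a \<in> bounded_ops UNIV UNIV" by (simp add: cont_invertible_def)
  then obtain C where "\<And>x. norm (a x) \<le> C * norm x" by (auto simp: bounded_ops_def)
  then show "cont_invertible UNIV (mixed a)"
    using * mixed_cont_invertible(1)[OF a assms(2)] by blast
qed (use assms(1)[unfolded M_iff[OF assms(2,3)]] in blast)+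

text \<open>Nonlocal H-convergence, freed from the unbounded operators.\<close>

definition mixed_converges :: "(nat \<Rightarrow> 'h \<Rightarrow> 'h) \<Rightarrow> ('h \<Rightarrow> 'h) \<Rightarrow> bool" where
  "mixed_converges a_seq a \<longleftrightarrow>
     (\<forall>x. weakly_converges (\<lambda>n. mixed_inv (a_seq n) x) (mixed_inv a x) \<and>
          weakly_converges (\<lambda>n. a_seq n (mixed_inv (a_seq n) x)) (a (mixed_inv a x)))"

end


section \<open>Weak limits of products\<close>

locale bounded_M_sequence = orthogonal_pair R0 R1
  for R0 R1 :: "'h::chilbert_space set" +
  fixes a_seq :: "nat \<Rightarrow> 'h \<Rightarrow> 'h" and \<alpha> \<beta> C :: real
  assumes pos: "\<alpha> > 0" "\<beta> > 0" and a_seq: "\<And>n. a_seq n \<in> M \<alpha> \<beta>"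
    and C: "C \<ge> 0" "\<And>n x. norm (a_seq n x) \<le> C * norm x"
begin

abbreviation "T n \<equiv> mixed_inv (a_seq n)"

lemmas a_seq_M = M_D[OF a_seq pos]

lemma a_seq_clinear: "clinear_on UNIV (a_seq n)"
  using a_seq_M(2)[of n] by (simp add: bounded_ops_def)

lemmas P_T = P_mixed_inv[OF a_seq_M(3)]

definition K where "K = (1 + C) / \<alpha> + 1"

lemma T_bound: "norm (T n x) \<le> K * norm x"
  using mixed_cont_invertible(2)[where a = "a_seq n" and q = "T n x",
      OF a_seq_M(2) pos(1) a_seq_M(4) C(2)]
  by (simp add: K_def mixed_mixed_inv[OF a_seq_M(3)])

lemma aT_bound: "norm (a_seq n (T n x)) \<le> (C * K) * norm x"
  using C(2)[of n "T n x"] mult_left_mono[OF T_bound[of n x] C(1)] by (simp add: mult.assoc)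

lemma T_clinear: "clinear_on UNIV (T n)"
  by (rule mixed_inv_clinear[OF a_seq_M(3)])

lemma aT_clinear: "clinear_on UNIV (\<lambda>x. a_seq n (T n x))"
  using T_clinear[of n] a_seq_clinear[of n] by (simp add: clinear_on_def)

text \<open>
  With \<open>x n = mixed (a n) (q n)\<close> one has \<open>q n = mixed_inv (a n) (x n)\<close>. Along subsequences \<open>x n\<close>
  converges strongly, so the weak operator convergence of the mixed inverses identifies the
  limits of \<open>q n\<close> and of \<open>a n (q n)\<close>.
\<close>

theorem mixed_converges_imp_product_converges:
  assumes a: "a \<in> M \<alpha> \<beta>" and conv: "mixed_converges a_seq a"
    and q: "weakly_converges q_seq q" and \<kappa>: "strict_mono \<kappa>"
    and compact0: "\<And>r::nat \<Rightarrow> nat. strict_mono r \<Longrightarrow>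
      \<exists>s. strict_mono s \<and> convergent (\<lambda>n. P0 (a_seq (\<kappa> (r (s n))) (q_seq (r (s n)))))"
    and compact1: "\<And>r::nat \<Rightarrow> nat. strict_mono r \<Longrightarrow>
      \<exists>s. strict_mono s \<and> convergent (\<lambda>n. P1 (q_seq (r (s n))))"
  shows "weakly_converges (\<lambda>n. a_seq (\<kappa> n) (q_seq n)) (a q)"
proof (rule weakly_converges_if_subsubseq)
  fix r :: "nat \<Rightarrow> nat" assume r: "strict_mono r"
  obtain s where s: "strict_mono s"
    and lim0: "convergent (\<lambda>n. P0 (a_seq (\<kappa> (r (s n))) (q_seq (r (s n)))))"
    using compact0[OF r] by blast
  obtain s' where s': "strict_mono s'"
    and lim1: "convergent (\<lambda>n. P1 (q_seq (r (s (s' n)))))"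
    using compact1[of "r \<circ> s"] r s by (auto simp: strict_mono_o)
  define \<sigma> where "\<sigma> = r \<circ> s \<circ> s'"
  have \<sigma>: "strict_mono \<sigma>" "strict_mono (\<kappa> \<circ> \<sigma>)"
    using r s s' \<kappa> by (auto simp: \<sigma>_def strict_mono_o)
  define x where "x n = mixed (a_seq (\<kappa> (\<sigma> n))) (q_seq (\<sigma> n))" for n
  have "convergent (\<lambda>n. P0 (a_seq (\<kappa> (\<sigma> n)) (q_seq (\<sigma> n))))"
    using convergent_subseq_convergent[OF lim0 s'] by (simp add: \<sigma>_def o_def)
  moreover have "convergent (\<lambda>n. P1 (q_seq (\<sigma> n)))"
    using lim1 by (simp add: \<sigma>_def)
  ultimately have "convergent x"
    unfolding x_def mixed_def by (rule convergent_add)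
  then obtain x0 where x0: "x \<longlonglongrightarrow> x0" by (auto simp: convergent_def)
  have Tx: "T (\<kappa> (\<sigma> n)) (x n) = q_seq (\<sigma> n)" for n
    by (simp add: x_def mixed_inv_mixed[OF a_seq_M(3)])
  have "weakly_converges (\<lambda>n. T (\<kappa> (\<sigma> n)) x0) (mixed_inv a x0)"
    using conv weakly_converges_subseq[OF _ \<sigma>(2)] by (fastforce simp: mixed_converges_def)
  from weakly_converges_apply[OF clinear_on_UNIV_imp_linear[OF T_clinear] T_bound this x0]
  have "weakly_converges (\<lambda>n. q_seq (\<sigma> n)) (mixed_inv a x0)"
    by (simp add: Tx)
  then have q_eq: "q = mixed_inv a x0"
    using weakly_converges_subseq[OF q \<sigma>(1)] by (metis weakly_converges_unique)
  have "weakly_converges (\<lambda>n. a_seq (\<kappa> (\<sigma> n)) (T (\<kappa> (\<sigma> n)) x0)) (a (mixed_inv a x0))"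
    using conv weakly_converges_subseq[OF _ \<sigma>(2)] by (fastforce simp: mixed_converges_def)
  from weakly_converges_apply[OF clinear_on_UNIV_imp_linear[OF aT_clinear] aT_bound this x0]
  have "weakly_converges (\<lambda>n. a_seq (\<kappa> (\<sigma> n)) (q_seq (\<sigma> n))) (a q)"
    by (simp add: Tx q_eq)
  then show "\<exists>s. strict_mono s \<and> weakly_converges (\<lambda>n. a_seq (\<kappa> (r (s n))) (q_seq (r (s n)))) (a q)"
    using s s' by (intro exI[of _ "s \<circ> s'"]) (auto simp: \<sigma>_def strict_mono_o)
qed

context
  fixes a :: "'h \<Rightarrow> 'h"
  assumes sep: "separable_space (euclidean :: 'h topology)"
    and a: "a \<in> bounded_ops UNIV UNIV"
    and product: "\<And>q_seq q \<kappa> y0 y1. weakly_converges q_seq q \<Longrightarrow> strict_mono \<kappa> \<Longrightarrow>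
      (\<And>n. P0 (a_seq (\<kappa> n) (q_seq n)) = y0) \<Longrightarrow> (\<And>n. P1 (q_seq n) = y1) \<Longrightarrow>
      weakly_converges (\<lambda>n. a_seq (\<kappa> n) (q_seq n)) (a q)"
begin

text \<open>
  The hypothesis applies to \<open>q n = T n x\<close>: its components \<open>P0 (a n (q n)) = P0 x\<close> and
  \<open>P1 (q n) = P1 x\<close> do not depend on \<open>n\<close>. Both identities pass to the weak limit.
\<close>

lemma weak_limit_of_mixed_inverses:
  assumes "strict_mono (r::nat \<Rightarrow> nat)"
  obtains s S where "strict_mono (s::nat \<Rightarrow> nat)" "S \<in> bounded_ops UNIV UNIV"
    and "\<And>x. norm (S x) \<le> K * norm x"
    and "\<And>x. weakly_converges (\<lambda>n. T (r (s n)) x) (S x)"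
    and "\<And>x. weakly_converges (\<lambda>n. a_seq (r (s n)) (T (r (s n)) x)) (a (S x))"
    and "\<And>x. mixed a (S x) = x"
proof -
  obtain s S where s: "strict_mono (s::nat \<Rightarrow> nat)" and S: "S \<in> bounded_ops UNIV UNIV"
    "\<And>x. norm (S x) \<le> K * norm x"
    and SW: "\<And>x. weakly_converges (\<lambda>n. T (r (s n)) x) (S x)"
    using weak_operator_compactness[OF sep T_clinear T_bound, of r] by auto
  have aSW: "weakly_converges (\<lambda>n. a_seq (r (s n)) (T (r (s n)) x)) (a (S x))" for x
    using product[OF SW, where \<kappa> = "r \<circ> s"] assms s by (simp add: strict_mono_o P_T)
  have "mixed a (S x) = x" for x
    unfolding mixed_eq_iff
  proof
    show "P0 (a (S x)) = P0 x"
      using weakly_converges_orth_proj[OF proj0 aSW[of x]]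
      by (intro weakly_converges_unique[OF _ weakly_converges_const]) (simp add: P_T)
    show "P1 (S x) = P1 x"
      using weakly_converges_orth_proj[OF proj1 SW[of x]]
      by (intro weakly_converges_unique[OF _ weakly_converges_const]) (simp add: P_T)
  qed
  from that[OF s S SW aSW this] show ?thesis .
qed

text \<open>
  For \<open>f \<in> R0\<close> the vector \<open>w = T n f\<close> lies in \<open>R0\<close> and \<open>\<langle>a n w, w\<rangle> = \<langle>f, T n f\<rangle>\<close>; for \<open>g \<in> R1\<close> the
  vector \<open>a n (T n g)\<close> lies in \<open>R1\<close> and its product with \<open>T n g\<close> is its product with \<open>g\<close>. So the
  quadratic forms that the class bounds from below are linear in the weakly convergent
  sequences and converge, while the norms are weakly lower semicontinuous.
\<close>

lemma limit_operator_coercive: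
  assumes s: "strict_mono (s::nat \<Rightarrow> nat)"
    and SW: "\<And>x. weakly_converges (\<lambda>n. T (s n) x) (S x)"
    and aSW: "\<And>x. weakly_converges (\<lambda>n. a_seq (s n) (T (s n) x)) (a (S x))"
  shows "f \<in> R0 \<Longrightarrow> S f \<in> R0" "f \<in> R0 \<Longrightarrow> 1 / \<beta> * (norm f)\<^sup>2 \<le> Re (cinner f (S f))"
    and "f \<in> R0 \<Longrightarrow> \<alpha> * (norm (S f))\<^sup>2 \<le> Re (cinner f (S f))"
    and "g \<in> R1 \<Longrightarrow> a (S g) \<in> R1" "g \<in> R1 \<Longrightarrow> \<alpha> * (norm g)\<^sup>2 \<le> Re (cinner g (a (S g)))"
    and "g \<in> R1 \<Longrightarrow> 1 / \<beta> * (norm (a (S g)))\<^sup>2 \<le> Re (cinner g (a (S g)))"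
proof -
  have const: "(\<lambda>n::nat. c) \<longlonglongrightarrow> c" for c :: real by simp
  {
    assume f: "f \<in> R0"
    have Tf: "T n f \<in> R0" for n
      using f by (intro in_R) (simp add: P_T)
    have eq: "cinner (a_seq n (T n f)) (T n f) = cinner f (T n f)" for n
      using cinner_orth_proj[OF proj0 Tf, of "a_seq n (T n f)" n] f by (simp add: P_T)
    have lim: "(\<lambda>n. Re (cinner f (T (s n) f))) \<longlonglongrightarrow> Re (cinner f (S f))"
      by (intro tendsto_Re weakly_convergesD SW)
    show "S f \<in> R0"
      using weak_limit_in[OF proj0 SW Tf] .
    have "1 / \<beta> * (norm f)\<^sup>2 \<le> Re (cinner f (T n f))" for n
      using a_seq_M(5)[OF Tf[of n], of n] f by (simp add: eq P_T)
    then show "1 / \<beta> * (norm f)\<^sup>2 \<le> Re (cinner f (S f))"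
      by (intro LIMSEQ_le_const[OF lim]) blast
    have "\<alpha> * (norm (T n f))\<^sup>2 \<le> Re (cinner f (T n f))" for n
      using a_seq_M(4)[OF Tf[of n], of n] by (simp add: eq)
    then show "\<alpha> * (norm (S f))\<^sup>2 \<le> Re (cinner f (S f))"
      using pos by (intro weak_limit_norm_le[OF SW _ lim]) simp_all
  next
    assume g: "g \<in> R1"
    have aTg: "a_seq n (T n g) \<in> R1" for n
      using g by (intro in_R) (simp add: P_T)
    have eq: "Re (cinner (T n g) (a_seq n (T n g))) = Re (cinner g (a_seq n (T n g)))" for n
      using cinner_orth_proj[OF proj1 aTg, of "T n g" n] g by (simp add: P_T)
    have lim: "(\<lambda>n. Re (cinner g (a_seq (s n) (T (s n) g)))) \<longlonglongrightarrow> Re (cinner g (a (S g)))"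
      by (intro tendsto_Re weakly_convergesD aSW)
    show "a (S g) \<in> R1"
      using weak_limit_in[OF proj1 aSW aTg] .
    have "\<alpha> * (norm g)\<^sup>2 \<le> Re (cinner g (a_seq n (T n g)))" for n
      using a_seq_M(7)[OF aTg[of n]] g by (simp add: eq P_T)
    then show "\<alpha> * (norm g)\<^sup>2 \<le> Re (cinner g (a (S g)))"
      by (intro LIMSEQ_le_const[OF lim]) blast
    have "1 / \<beta> * (norm (a_seq n (T n g)))\<^sup>2 \<le> Re (cinner g (a_seq n (T n g)))" for n
      using a_seq_M(6)[OF aTg[of n]] by (simp add: eq)
    then show "1 / \<beta> * (norm (a (S g)))\<^sup>2 \<le> Re (cinner g (a (S g)))"
      using pos by (intro weak_limit_norm_le[OF aSW _ lim]) simp_all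
  }
qed

text \<open>
  The weak limit \<open>S\<close> is a right inverse of \<open>mixed a\<close>. Its coercivity on \<open>R0\<close> makes it a two-sided
  inverse, and coercivity of \<open>a \<circ> S\<close> on \<open>R1\<close> makes \<open>a\<close> invertible. As \<open>S\<close> is then the inverse of
  \<open>mixed a\<close> for every subsequence, the whole sequence converges.
\<close>

theorem product_converges_imp_M: "a \<in> M \<alpha> \<beta>"
  and product_converges_imp_mixed_converges: "mixed_converges a_seq a"
proof -
  have lin: "clinear_on UNIV a" using a by (simp add: bounded_ops_def)
  obtain C' where C': "\<And>x. norm (a x) \<le> C' * norm x" using a by (auto simp: bounded_ops_def)
  have C'0: "norm (a x) \<le> \<bar>C'\<bar> * norm x" for x
    using C'[of x] mult_right_mono[OF abs_ge_self[of C'] norm_ge_zero[of x]] by linarith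
  obtain s S where s: "strict_mono (s::nat \<Rightarrow> nat)" and S: "S \<in> bounded_ops UNIV UNIV"
    and S_le: "\<And>x. norm (S x) \<le> K * norm x"
    and SW: "\<And>x. weakly_converges (\<lambda>n. T (s n) x) (S x)"
    and aSW: "\<And>x. weakly_converges (\<lambda>n. a_seq (s n) (T (s n) x)) (a (S x))"
    and S_right: "\<And>x. mixed a (S x) = x"
    by (rule weak_limit_of_mixed_inverses[of "\<lambda>n. n"]) (simp add: strict_mono_def, rule that)
  note limit = limit_operator_coercive[OF s SW aSW]
  have linS: "clinear_on UNIV S" using S by (simp add: bounded_ops_def)
  have "S \<in> bounded_ops R0 R0"
    using S limit(1) by (auto simp: bounded_ops_def clinear_on_def)
  \<comment> \<open>\<open>mixed a\<close> is injective, since its kernel lies in \<open>R0 = S ` R0\<close> and \<open>mixed a \<circ> S = id\<close>\<close>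
  from coercive_surj[OF proj0 this, of "1 / \<beta>"] limit(2) pos
  have S_surj: "\<exists>f\<in>R0. S f = w" if "w \<in> R0" for w
    using that by (metis Re_cinner_commute zero_less_divide_1_iff)
  have S_left: "S (mixed a q) = q" for q
  proof -
    define d where "d = S (mixed a q) - q"
    have "mixed a d = 0"
      using mixed_bounded_ops[OF a] by (simp add: d_def S_right bounded_ops_def
          clinear_on_diff[OF complex_vector.subspace_UNIV])
    moreover from this have "P1 d = 0" using P_mixed(2)[of a d] by simp
    then obtain f where "d = S f" using S_surj[OF in_R(1)] by metis
    ultimately have "d = S 0" using S_right by metis
    then show ?thesis
      by (simp add: d_def clinear_on_0[OF linS complex_vector.subspace_UNIV])
  qed
  have inv: "cont_invertible UNIV (mixed a)"
    using mixed_bounded_ops[OF a]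
    by (rule cont_invertibleI[where K = K, rotated]) (use S_right S_le S_left in \<open>auto, metis\<close>)
  have bounds0: "\<alpha> * (norm q)\<^sup>2 \<le> Re (cinner (a q) q)"
      "1 / \<beta> * (norm (P0 (a q)))\<^sup>2 \<le> Re (cinner (a q) q)" if q: "q \<in> R0" for q
  proof -
    have f: "mixed a q = P0 (a q)" using q by (simp add: mixed_def)
    then have "S (P0 (a q)) = q" using S_left by metis
    then show "\<alpha> * (norm q)\<^sup>2 \<le> Re (cinner (a q) q)"
      "1 / \<beta> * (norm (P0 (a q)))\<^sup>2 \<le> Re (cinner (a q) q)"
      using limit(2,3)[of "P0 (a q)"] q by (simp_all add: cinner_orth_proj[OF proj0])
  qed
  have bounds1: "1 / \<beta> * (norm (a q))\<^sup>2 \<le> Re (cinner q (a q))"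
      "\<alpha> * (norm (P1 q))\<^sup>2 \<le> Re (cinner q (a q))" if q: "a q \<in> R1" for q
  proof -
    have f: "mixed a q = P1 q" using q by (simp add: mixed_def)
    then have "S (P1 q) = q" using S_left by metis
    then show "1 / \<beta> * (norm (a q))\<^sup>2 \<le> Re (cinner q (a q))"
      "\<alpha> * (norm (P1 q))\<^sup>2 \<le> Re (cinner q (a q))"
      using limit(5,6)[of "P1 q"] q by (simp_all add: cinner_orth_proj[OF proj1])
  qed
  have aS: "(\<lambda>x. a (S x)) \<in> bounded_ops R1 R1"
  proof -
    have "norm (a (S x)) \<le> \<bar>C'\<bar> * K * norm x" for x
      using C'0[of "S x"] mult_left_mono[OF S_le[of x] abs_ge_zero[of C']] by (simp add: mult.assoc)
    moreover have "clinear_on R1 (\<lambda>x. a (S x))"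
      using lin linS by (simp add: clinear_on_def)
    ultimately show ?thesis
      using limit(4) by (auto simp: bounded_ops_def)
  qed
  \<comment> \<open>solve \<open>a (S x) = y\<close> by \<open>x = P0 y + g\<close> with \<open>g \<in> R1\<close>, for \<open>a \<circ> S\<close> preserves the \<open>R0\<close>-component\<close>
  have surj: "\<exists>q. a q = y" for y
  proof -
    obtain g where g: "g \<in> R1" "a (S g) = P1 (y - a (S (P0 y)))"
      using coercive_surj[OF proj1 aS pos(1), of "P1 (y - a (S (P0 y)))"] limit(5) P_in(2)
      by (auto simp del: P_diff simp: Re_cinner_commute[of "a (S _)"])
    have P0aS: "P0 (a (S x)) = P0 x" for x
      using S_right[of x] P_mixed(1) by metis
    have "a (S (P0 y + g)) = y"
      by (rule P_eqI)
        (use g in \<open>simp_all add: clinear_on_add[OF lin] clinear_on_add[OF linS] P0aS\<close>)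
    then show ?thesis by blast
  qed
  have below: "norm q \<le> \<bar>K\<bar> * (1 + (1 + \<bar>C'\<bar> * \<bar>K\<bar>) / \<alpha>) * norm (a q)" for q
  proof -
    define y where "y = a q"
    define g where "g = P1 q"
    have m: "mixed a q = P0 y + g" by (simp add: mixed_def y_def g_def)
    have q: "q = S (P0 y) + S g"
      using S_left[of q] by (simp add: m clinear_on_add[OF linS])
    have S_le': "norm (S x) \<le> \<bar>K\<bar> * norm x" for x
      using S_le[of x] mult_right_mono[OF abs_ge_self[of K] norm_ge_zero[of x]] by linarith
    have ag: "a (S g) = y - a (S (P0 y))"
      using clinear_on_add[OF lin, of "S (P0 y)" "S g"] q
      by (metis UNIV_I add_diff_cancel_left' y_def)
    have "norm g \<le> norm (a (S g)) / \<alpha>"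
      using limit(5)[of g] pos
      by (intro coercive_norm_le) (simp_all add: g_def Re_cinner_commute[of "a (S _)"])
    also have "\<dots> \<le> (1 + \<bar>C'\<bar> * \<bar>K\<bar>) * norm y / \<alpha>"
    proof -
      have "norm (a (S (P0 y))) \<le> \<bar>C'\<bar> * (\<bar>K\<bar> * norm y)"
        by (meson C'0 S_le' P_norm(1) abs_ge_zero mult_left_mono order_trans)
      then show ?thesis
        using norm_triangle_ineq4[of y "a (S (P0 y))"] pos
        by (intro divide_right_mono) (simp_all add: ag distrib_right mult.assoc)
    qed
    finally have g: "norm g \<le> (1 + \<bar>C'\<bar> * \<bar>K\<bar>) * norm y / \<alpha>" .
    have "norm q \<le> \<bar>K\<bar> * norm (P0 y) + \<bar>K\<bar> * norm g"
      using norm_triangle_ineq[of "S (P0 y)" "S g"] S_le'[of "P0 y"] S_le'[of g] q by simp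
    also have "\<dots> \<le> \<bar>K\<bar> * norm y + \<bar>K\<bar> * ((1 + \<bar>C'\<bar> * \<bar>K\<bar>) * norm y / \<alpha>)"
      using P_norm(1)[of y] g by (intro add_mono mult_left_mono) auto
    also have "\<dots> = \<bar>K\<bar> * (1 + (1 + \<bar>C'\<bar> * \<bar>K\<bar>) / \<alpha>) * norm y"
      by (simp add: algebra_simps)
    finally show ?thesis by (simp add: y_def)
  qed
  have "cont_invertible UNIV a"
    using surj below by (intro cont_invertibleI[OF complex_vector.subspace_UNIV a]) auto
  then show "a \<in> M \<alpha> \<beta>"
    unfolding M_iff[OF pos] using bounds0 bounds1 by blast
  show "mixed_converges a_seq a"
    unfolding mixed_converges_def
  proof (intro allI conjI; rule weakly_converges_if_subsubseq)
    fix x and r :: "nat \<Rightarrow> nat" assume r: "strict_mono r"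
    obtain s S where s: "strict_mono (s::nat \<Rightarrow> nat)"
      and SW: "\<And>x. weakly_converges (\<lambda>n. T (r (s n)) x) (S x)"
      and aSW: "\<And>x. weakly_converges (\<lambda>n. a_seq (r (s n)) (T (r (s n)) x)) (a (S x))"
      and S_right: "\<And>x. mixed a (S x) = x"
      by (rule weak_limit_of_mixed_inverses[OF r]) (rule that)
    have "S x = mixed_inv a x"
      using mixed_inv_mixed[OF inv, of "S x"] S_right by simp
    then show "\<exists>s. strict_mono s \<and> weakly_converges (\<lambda>n. T (r (s n)) x) (mixed_inv a x)"
      and "\<exists>s. strict_mono s \<and>
             weakly_converges (\<lambda>n. a_seq (r (s n)) (T (r (s n)) x)) (a (mixed_inv a x))"
      using s SW[of x] aSW[of x] by auto
  qed
qed

end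

end

section \<open>Closed operators with closed range\<close>

lemma app_in_ran: "x \<in> dom A \<Longrightarrow> A \<cdot> x \<in> ran A"
  by (auto simp: ran_def)

lemma ran_obtain:
  assumes "y \<in> ran A"
  obtains x where "x \<in> dom A" "A \<cdot> x = y"
  using assms by (force simp: ran_def)

lemma app_Some: "x \<in> dom A \<Longrightarrow> A x = Some (A \<cdot> x)"
  by auto

locale linear_operator =
  fixes A :: "'a::chilbert_space \<rightharpoonup> 'b::chilbert_space"
  assumes dom: "csubspace (dom A)" and lin: "clinear_on (dom A) (\<lambda>x. A \<cdot> x)"
begin

lemma csubspace_ran: "csubspace (ran A)"
proof (rule complex_vector.subspaceI)
  show "0 \<in> ran A"
    using app_in_ran[OF complex_vector.subspace_0[OF dom]] clinear_on_0[OF lin dom] by simp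
next
  fix y z assume "y \<in> ran A" "z \<in> ran A"
  then obtain u v where "u \<in> dom A" "A \<cdot> u = y" "v \<in> dom A" "A \<cdot> v = z"
    by (meson ran_obtain)
  then show "y + z \<in> ran A"
    using app_in_ran[OF complex_vector.subspace_add[OF dom]] clinear_on_add[OF lin] by metis
next
  fix c y assume "y \<in> ran A"
  then obtain u where "u \<in> dom A" "A \<cdot> u = y"
    by (meson ran_obtain)
  then show "c *\<^sub>C y \<in> ran A"
    using app_in_ran[OF complex_vector.subspace_scale[OF dom]] clinear_on_scaleC[OF lin] by metis
qed

lemma kern_iff: "x \<in> kern A \<longleftrightarrow> x \<in> dom A \<and> A \<cdot> x = 0"
  by (auto simp: kern_def)

lemma csubspace_kern: "csubspace (kern A)"
  using complex_vector.subspace_0[OF dom] clinear_on_0[OF lin dom]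
  by (auto simp: complex_vector.subspace_def kern_iff clinear_on_add[OF lin] clinear_on_scaleC[OF lin]
      complex_vector.subspace_add[OF dom] complex_vector.subspace_scale[OF dom])

end

locale closed_operator = linear_operator +
  assumes dense: "closure (dom A) = UNIV" and closed_graph: "closed (Map.graph A)"
begin

lemma closed_graphD:
  assumes "\<And>n. x n \<in> dom A" "x \<longlonglongrightarrow> l" "(\<lambda>n. A \<cdot> x n) \<longlonglongrightarrow> m"
  shows "l \<in> dom A" "A \<cdot> l = m"
proof -
  have "(l, m) \<in> Map.graph A"
  proof (rule closed_sequentially[OF closed_graph])
    show "(x n, A \<cdot> x n) \<in> Map.graph A" for n
      using app_Some[OF assms(1)] by (simp add: in_graphI)
    show "(\<lambda>n. (x n, A \<cdot> x n)) \<longlonglongrightarrow> (l, m)"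
      using assms(2,3) by (rule tendsto_Pair)
  qed
  then show "l \<in> dom A" "A \<cdot> l = m"
    by (auto dest: in_graphD)
qed

lemma closed_kern: "closed (kern A)"
  unfolding closed_sequential_limits
proof clarify
  fix x l assume "\<forall>n. x n \<in> kern A" "x \<longlonglongrightarrow> l"
  then have "\<And>n. x n \<in> dom A" "(\<lambda>n. A \<cdot> x n) \<longlonglongrightarrow> 0"
    by (simp_all add: kern_iff)
  with closed_graphD[of x l 0] \<open>x \<longlonglongrightarrow> l\<close> show "l \<in> kern A"
    by (simp add: kern_iff)
qed

text \<open>
  Baire's theorem, as in the proof of the open mapping theorem: the closures of the images of
  the balls of radius \<open>n\<close> cover the complete space \<open>ran A\<close>, so one of them contains a ball,
  and by symmetry and convexity a ball around \<open>0\<close>.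
\<close>

lemma approximate_bounded_preimages:
  assumes "closed (ran A)"
  shows "\<exists>c\<ge>0. \<forall>y\<in>ran A. \<forall>\<delta>>0. \<exists>x\<in>dom A. norm x \<le> c * norm y \<and> norm (A \<cdot> x - y) < \<delta>"
proof -
  let ?R = "ran A" and ?X = "top_of_set (ran A)"
  define F where "F n = closure ((\<lambda>x. A \<cdot> x) ` {x \<in> dom A. norm x \<le> real n})" for n :: nat
  have FR: "F n \<subseteq> ?R" for n
    unfolding F_def using assms by (intro closure_minimal) (auto intro: ranI)
  have R0: "0 \<in> ?R" by (rule complex_vector.subspace_0[OF csubspace_ran])
  have "\<exists>n. ?X interior_of F n \<noteq> {}"
  proof (rule ccontr)
    assume "\<not> ?thesis"
    then have "?X interior_of \<Union>(range F) = {}"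
    proof (intro Baire_category_alt)
      have "completely_metrizable_space ?X"
        using assms by (intro completely_metrizable_space_closedin completely_metrizable_space_euclidean)
          auto
      then show "completely_metrizable_space ?X \<or> locally_compact_space ?X \<and> regular_space ?X" ..
    qed (use FR in \<open>auto simp: F_def closedin_closed_eq assms\<close>)
    moreover have "\<Union>(range F) = ?R"
    proof
      show "?R \<subseteq> \<Union>(range F)"
      proof
        fix y assume "y \<in> ?R"
        then obtain x where x: "x \<in> dom A" "A \<cdot> x = y" by (rule ran_obtain)
        obtain n where "norm x \<le> real n" using real_arch_simple by blast
        with x have "y \<in> F n" unfolding F_def by (intro subsetD[OF closure_subset]) auto
        then show "y \<in> \<Union>(range F)" by blast
      qed
    qed (use FR in auto)
    moreover have "?X interior_of ?R = ?R"
      using interior_of_topspace[of ?X] by simp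
    ultimately show False using R0 by auto
  qed
  then obtain n y0 where "y0 \<in> ?X interior_of F n" by blast
  then obtain U where U: "openin ?X U" "y0 \<in> U" "U \<subseteq> F n"
    by (auto simp: interior_of_def)
  then obtain e where e: "e > 0" "ball y0 e \<inter> ?R \<subseteq> U"
    unfolding openin_contains_ball by blast
  have y0: "y0 \<in> ?R" using U FR by blast
  have small: "\<exists>x\<in>dom A. norm x \<le> real n \<and> norm (A \<cdot> x - y) < \<delta>"
    if y: "y \<in> ?R" "norm y < e" and \<delta>: "\<delta> > 0" for y \<delta>
  proof -
    have "y0 + y \<in> F n" "y0 - y \<in> F n"
      using e U(3) y y0 csubspace_ran
      by (auto simp: subset_eq dist_norm complex_vector.subspace_add complex_vector.subspace_diff)
    then obtain u v where u: "u \<in> dom A" "norm u \<le> real n" "norm (A \<cdot> u - (y0 + y)) < \<delta>"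
      and v: "v \<in> dom A" "norm v \<le> real n" "norm (A \<cdot> v - (y0 - y)) < \<delta>"
      using \<delta> unfolding F_def closure_approachable dist_norm by blast
    let ?x = "(1/2) *\<^sub>R (u - v)"
    have "u - v \<in> dom A" using u v by (simp add: complex_vector.subspace_diff[OF dom])
    then have "?x \<in> dom A" "A \<cdot> ?x = (1/2) *\<^sub>R (A \<cdot> u - A \<cdot> v)"
      using clinear_on_diff[OF dom lin u(1) v(1)] clinear_on_scaleR[OF lin, of "u - v" "1/2"]
      by (simp_all add: csubspace_scaleR[OF dom])
    moreover have "norm ?x \<le> real n"
      using norm_triangle_ineq4[of u v] u v by simp
    moreover have "(1/2) *\<^sub>R (A \<cdot> u - A \<cdot> v) - y
        = (1/2) *\<^sub>R ((A \<cdot> u - (y0 + y)) - (A \<cdot> v - (y0 - y)))"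
      by (simp add: algebra_simps flip: scaleR_add_left)
    moreover have "norm ((1/2) *\<^sub>R ((A \<cdot> u - (y0 + y)) - (A \<cdot> v - (y0 - y)))) < \<delta>"
      using norm_triangle_ineq4[of "A \<cdot> u - (y0 + y)" "A \<cdot> v - (y0 - y)"] u(3) v(3) by simp
    ultimately show ?thesis by metis
  qed
  have "\<exists>x\<in>dom A. norm x \<le> 2 * real n / e * norm y \<and> norm (A \<cdot> x - y) < \<delta>"
    if y: "y \<in> ?R" and \<delta>: "\<delta> > 0" for y \<delta>
  proof (cases "y = 0")
    case True
    then show ?thesis
      using \<delta> complex_vector.subspace_0[OF dom] clinear_on_0[OF lin dom] by (intro bexI[of _ 0]) auto
  next
    case False
    define t where "t = e / (2 * norm y)"
    have t: "t > 0" using False e by (simp add: t_def)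
    have "norm (t *\<^sub>R y) < e" using False e by (simp add: t_def)
    then obtain x where x: "x \<in> dom A" "norm x \<le> real n" "norm (A \<cdot> x - t *\<^sub>R y) < t * \<delta>"
      using small[of "t *\<^sub>R y" "t * \<delta>"] t \<delta> y csubspace_scaleR[OF csubspace_ran] by auto
    let ?x = "(1/t) *\<^sub>R x"
    have "?x \<in> dom A" using x by (simp add: csubspace_scaleR[OF dom])
    moreover have "norm ?x \<le> 2 * real n / e * norm y"
      using x(2) t e False by (simp add: t_def field_simps)
    moreover have "norm (A \<cdot> ?x - y) < \<delta>"
    proof -
      have "A \<cdot> ?x - y = (1/t) *\<^sub>R (A \<cdot> x - t *\<^sub>R y)"
        using clinear_on_scaleR[OF lin x(1), of "1/t"] t by (simp add: scaleR_diff_right)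
      then show ?thesis
        using x(3) t by (simp only: norm_scaleR) (simp add: pos_divide_less_eq mult.commute)
    qed
    ultimately show ?thesis by blast
  qed
  moreover have "0 \<le> 2 * real n / e" using e by simp
  ultimately show ?thesis by blast
qed

text \<open>
  Successive approximation removes the error: the residual after \<open>k\<close> steps is at most \<open>\<parallel>y\<parallel> / 2 ^ k\<close>,
  the corrections sum up, and closedness of the graph identifies the image of the sum.
\<close>

theorem bounded_preimages:
  assumes "closed (ran A)"
  shows "\<exists>c\<ge>0. \<forall>y\<in>ran A. \<exists>x\<in>dom A. A \<cdot> x = y \<and> norm x \<le> c * norm y"
proof -
  obtain c where c: "c \<ge> 0" and approx:
    "\<And>y \<delta>. y \<in> ran A \<Longrightarrow> \<delta> > 0 \<Longrightarrow> \<exists>x\<in>dom A. norm x \<le> c * norm y \<and> norm (A \<cdot> x - y) < \<delta>"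
    using approximate_bounded_preimages[OF assms] by blast
  have "\<exists>x\<in>dom A. A \<cdot> x = y \<and> norm x \<le> 2 * c * norm y" if y: "y \<in> ran A" for y
  proof (cases "y = 0")
    case True
    then show ?thesis
      using complex_vector.subspace_0[OF dom] clinear_on_0[OF lin dom] by (intro bexI[of _ 0]) auto
  next
    case False
    have "\<exists>\<rho>. \<forall>k. (\<rho> k \<in> ran A \<and> norm (\<rho> k) \<le> norm y * (1/2) ^ k \<and> (k = 0 \<longrightarrow> \<rho> k = y)) \<and>
        (\<exists>x\<in>dom A. norm x \<le> c * norm (\<rho> k) \<and> \<rho> (Suc k) = \<rho> k - A \<cdot> x)"
    proof (rule dependent_nat_choice)
      show "\<exists>r. r \<in> ran A \<and> norm r \<le> norm y * (1/2) ^ 0 \<and> (0 = 0 \<longrightarrow> r = y)"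
        using y by auto
    next
      fix r k assume r: "r \<in> ran A \<and> norm r \<le> norm y * (1/2) ^ k \<and> (k = 0 \<longrightarrow> r = y)"
      obtain x where x: "x \<in> dom A" "norm x \<le> c * norm r" "norm (A \<cdot> x - r) < norm y * (1/2) ^ Suc k"
        using approx[of r "norm y * (1/2) ^ Suc k"] r False by auto
      then have "r - A \<cdot> x \<in> ran A" "norm (r - A \<cdot> x) \<le> norm y * (1/2) ^ Suc k"
        using r by (simp_all add: complex_vector.subspace_diff[OF csubspace_ran] app_in_ran
            norm_minus_commute)
      then show "\<exists>r'. (r' \<in> ran A \<and> norm r' \<le> norm y * (1/2) ^ Suc k \<and> (Suc k = 0 \<longrightarrow> r' = y)) \<and>
          (\<exists>x\<in>dom A. norm x \<le> c * norm r \<and> r' = r - A \<cdot> x)"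
        using x by blast
    qed
    then obtain \<rho> where \<rho>: "\<And>k. norm (\<rho> k) \<le> norm y * (1/2) ^ k" "\<rho> 0 = y"
      and step: "\<And>k. \<exists>x\<in>dom A. norm x \<le> c * norm (\<rho> k) \<and> \<rho> (Suc k) = \<rho> k - A \<cdot> x"
      by blast
    from step obtain x where x: "\<And>k. x k \<in> dom A" "\<And>k. norm (x k) \<le> c * norm (\<rho> k)"
      "\<And>k. \<rho> (Suc k) = \<rho> k - A \<cdot> x k"
      by metis
    have x_le: "norm (x k) \<le> c * norm y * (1/2) ^ k" for k
      using order_trans[OF x(2) mult_left_mono[OF \<rho>(1) c]] by (simp add: mult.assoc)
    have geo: "(\<lambda>k. c * norm y * (1/2) ^ k) sums (c * norm y * 2)"
      using sums_mult[OF geometric_sums[of "1/2::real"], of "c * norm y"] by simp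
    have summable_norm_x: "summable (\<lambda>k. norm (x k))"
      by (rule summable_comparison_test'[OF sums_summable[OF geo]]) (use x_le in simp)
    have x_sums: "x sums suminf x"
      by (rule summable_sums[OF summable_norm_cancel[OF summable_norm_x]])
    have part: "(\<Sum>k<n. x k) \<in> dom A \<and> A \<cdot> (\<Sum>k<n. x k) = y - \<rho> n" for n
    proof (induction n)
      case 0
      then show ?case
        using complex_vector.subspace_0[OF dom] clinear_on_0[OF lin dom] \<rho>(2) by simp
    next
      case (Suc n)
      then show ?case
        using x(1,3) clinear_on_add[OF lin, of "\<Sum>k<n. x k" "x n"]
        by (simp add: complex_vector.subspace_add[OF dom])
    qed
    have "\<rho> \<longlonglongrightarrow> 0"
    proof (rule Lim_null_comparison)
      show "\<forall>\<^sub>F k in sequentially. norm (\<rho> k) \<le> norm y * (1/2) ^ k"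
        using \<rho>(1) by simp
      show "(\<lambda>k. norm y * (1/2) ^ k) \<longlonglongrightarrow> 0"
        by (intro tendsto_mult_right_zero LIMSEQ_realpow_zero) auto
    qed
    then have "(\<lambda>n. A \<cdot> (\<Sum>k<n. x k)) \<longlonglongrightarrow> y"
      using part tendsto_diff[OF tendsto_const[of y], of \<rho> 0] by simp
    with closed_graphD[of "\<lambda>n. \<Sum>k<n. x k" "suminf x" y] part x_sums
    have "suminf x \<in> dom A" "A \<cdot> suminf x = y"
      by (simp_all add: sums_def)
    moreover have "norm (suminf x) \<le> 2 * c * norm y"
    proof -
      have "norm (suminf x) \<le> (\<Sum>k. norm (x k))"
        by (rule summable_norm[OF summable_norm_x])
      also have "\<dots> \<le> (\<Sum>k. c * norm y * (1/2) ^ k)"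
        by (rule suminf_le[OF x_le summable_norm_x sums_summable[OF geo]])
      finally show ?thesis using sums_unique[OF geo] by simp
    qed
    ultimately show ?thesis by blast
  qed
  then show ?thesis using c by (intro exI[of _ "2 * c"]) auto
qed

lemma adj_eq_Some_iff: "adj A y = Some z \<longleftrightarrow> (\<forall>x\<in>dom A. cinner y (A \<cdot> x) = cinner z x)"
proof -
  have unique: "z = z'" if zz': "\<forall>x\<in>dom A. cinner y (A \<cdot> x) = cinner z x"
    "\<forall>x\<in>dom A. cinner y (A \<cdot> x) = cinner z' x" for z z'
  proof -
    obtain x where x: "\<And>n. x n \<in> dom A" "x \<longlonglongrightarrow> z - z'"
      using dense closure_sequential[of "z - z'" "dom A"] by auto
    have "(\<lambda>n. cinner (z - z') (x n)) = (\<lambda>n. 0)"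
      using zz' x(1) by (auto simp: cinner_simps)
    then have "cinner (z - z') (z - z') = 0"
      using tendsto_cinner[OF tendsto_const x(2), of "z - z'"] LIMSEQ_unique tendsto_const by metis
    then show ?thesis by (simp add: cinner_self)
  qed
  show ?thesis
  proof
    assume *: "\<forall>x\<in>dom A. cinner y (A \<cdot> x) = cinner z x"
    with unique have "\<exists>!z. \<forall>x\<in>dom A. cinner y (A \<cdot> x) = cinner z x" by blast
    moreover from this * have "(THE z. \<forall>x\<in>dom A. cinner y (A \<cdot> x) = cinner z x) = z"
      by (rule the1_equality)
    ultimately show "adj A y = Some z" by (simp add: adj_def)
  next
    assume "adj A y = Some z"
    then have "\<exists>!z. \<forall>x\<in>dom A. cinner y (A \<cdot> x) = cinner z x"
      and z: "z = (THE z. \<forall>x\<in>dom A. cinner y (A \<cdot> x) = cinner z x)"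
      by (auto simp: adj_def split: if_splits)
    from theI'[OF this(1)] show "\<forall>x\<in>dom A. cinner y (A \<cdot> x) = cinner z x"
      unfolding z .
  qed
qed

lemma cinner_adj: "y \<in> dom (adj A) \<Longrightarrow> x \<in> dom A \<Longrightarrow> cinner (adj A \<cdot> y) x = cinner y (A \<cdot> x)"
  using app_Some[of y "adj A"] unfolding adj_eq_Some_iff by simp

lemma adj_linear_operator: "linear_operator (adj A)"
proof -
  have "adj A 0 = Some 0" by (simp add: adj_eq_Some_iff)
  have add: "adj A (x + y) = Some (adj A \<cdot> x + adj A \<cdot> y)" if "x \<in> dom (adj A)" "y \<in> dom (adj A)" for x y
    using that by (simp add: adj_eq_Some_iff cinner_simps cinner_adj)
  have scale: "adj A (c *\<^sub>C x) = Some (c *\<^sub>C (adj A \<cdot> x))" if "x \<in> dom (adj A)" for c x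
    using that by (simp add: adj_eq_Some_iff cinner_simps cinner_adj)
  show ?thesis
  proof
    show "csubspace (dom (adj A))"
      using \<open>adj A 0 = Some 0\<close> add scale by (intro complex_vector.subspaceI) (blast intro: domI)+
    show "clinear_on (dom (adj A)) (\<lambda>x. adj A \<cdot> x)"
      unfolding clinear_on_def using add scale by simp
  qed
qed

text \<open>
  For \<open>y \<perp> ker A\<close> the functional \<open>A x \<mapsto> \<langle>y, x\<rangle>\<close> on \<open>ran A\<close> is well defined, and bounded by the
  bounded choice of preimages; the vector \<open>z \<in> ran A\<close> that represents it satisfies \<open>A\<^sup>* z = y\<close>.
\<close>

lemma adj_preimage_in_ran:
  assumes "closed (ran A)" and y: "\<And>x. x \<in> kern A \<Longrightarrow> cinner y x = 0"
  shows "\<exists>z\<in>ran A. adj A z = Some y"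
proof -
  obtain c where c: "c \<ge> 0" "\<forall>r\<in>ran A. \<exists>x\<in>dom A. A \<cdot> x = r \<and> norm x \<le> c * norm r"
    using bounded_preimages[OF assms(1)] by blast
  then obtain g where g: "\<And>r. r \<in> ran A \<Longrightarrow> g r \<in> dom A" "\<And>r. r \<in> ran A \<Longrightarrow> A \<cdot> g r = r"
    "\<And>r. r \<in> ran A \<Longrightarrow> norm (g r) \<le> c * norm r"
    by metis
  have eq: "cinner y (g r) = cinner y x" if "r \<in> ran A" "x \<in> dom A" "A \<cdot> x = r" for r x
  proof -
    have "g r - x \<in> kern A"
      using that g by (simp add: kern_iff complex_vector.subspace_diff[OF dom] clinear_on_diff[OF dom lin])
    then show ?thesis using y by (fastforce simp: cinner_simps)
  qed
  have "\<exists>z\<in>ran A. \<forall>r\<in>ran A. cinner y (g r) = cinner z r"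
  proof (rule Riesz_representation[OF csubspace_ran assms(1), where C = "norm y * c"])
    show "clinear_on (ran A) (\<lambda>r. cinner y (g r))"
      unfolding clinear_on_def
    proof (intro conjI ballI allI)
      fix r s assume rs: "r \<in> ran A" "s \<in> ran A"
      then have "cinner y (g (r + s)) = cinner y (g r + g s)"
        by (intro eq) (simp_all add: g complex_vector.subspace_add[OF csubspace_ran]
            complex_vector.subspace_add[OF dom] clinear_on_add[OF lin])
      then show "cinner y (g (r + s)) = cinner y (g r) + cinner y (g s)"
        by (simp add: cinner_simps)
    next
      fix k r assume r: "r \<in> ran A"
      then have "cinner y (g (k *\<^sub>C r)) = cinner y (k *\<^sub>C g r)"
        by (intro eq) (simp_all add: g complex_vector.subspace_scale[OF csubspace_ran]
            complex_vector.subspace_scale[OF dom] clinear_on_scaleC[OF lin])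
      then show "cinner y (g (k *\<^sub>C r)) = k *\<^sub>C cinner y (g r)"
        by (simp add: cinner_simps scaleC_complex_def)
    qed
    show "cmod (cinner y (g r)) \<le> norm y * c * norm r" if "r \<in> ran A" for r
      using order_trans[OF norm_cinner_le mult_left_mono[OF g(3)[OF that] norm_ge_zero[of y]]]
      by (simp add: mult.assoc)
  qed
  then obtain z where z: "z \<in> ran A" "\<And>r. r \<in> ran A \<Longrightarrow> cinner y (g r) = cinner z r" by blast
  have "adj A z = Some y"
    using z(2) eq app_in_ran by (metis adj_eq_Some_iff)
  with z(1) show ?thesis by blast
qed

theorem ran_adj:
  assumes "closed (ran A)"
  shows "ran (adj A) = {y. \<forall>x\<in>kern A. cinner y x = 0}"
proof
  show "ran (adj A) \<subseteq> {y. \<forall>x\<in>kern A. cinner y x = 0}"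
    by (auto simp: ran_def adj_eq_Some_iff kern_iff) (metis (full_types) cinner_zero(2) domI option.sel)
  show "{y. \<forall>x\<in>kern A. cinner y x = 0} \<subseteq> ran (adj A)"
    using adj_preimage_in_ran[OF assms] by (force simp: ran_def)
qed

text \<open>A vector orthogonal to the kernel is the shortest preimage of its image.\<close>

lemma bounded_below_on_kern_perp:
  assumes "closed (ran A)"
  shows "\<exists>c\<ge>0. \<forall>v\<in>dom A \<inter> ran (adj A). norm v \<le> c * norm (A \<cdot> v)"
proof -
  obtain c where c: "c \<ge> 0" "\<And>y. y \<in> ran A \<Longrightarrow> \<exists>x\<in>dom A. A \<cdot> x = y \<and> norm x \<le> c * norm y"
    using bounded_preimages[OF assms] by blast
  have "norm v \<le> c * norm (A \<cdot> v)" if v: "v \<in> dom A" "v \<in> ran (adj A)" for v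
  proof -
    obtain x where x: "x \<in> dom A" "A \<cdot> x = A \<cdot> v" "norm x \<le> c * norm (A \<cdot> v)"
      using c(2)[OF app_in_ran[OF v(1)]] by blast
    have "x - v \<in> kern A"
      using x v by (simp add: kern_iff complex_vector.subspace_diff[OF dom] clinear_on_diff[OF dom lin])
    then have "cinner v (x - v) = 0"
      using v(2) unfolding ran_adj[OF assms] by blast
    then have "cinner v x = cinner v v" by (simp add: cinner_simps)
    with norm_cinner_le[of v x] have "norm v * norm v \<le> norm v * norm x"
      by (simp add: cinner_self power2_eq_square norm_mult)
    then have "norm v \<le> norm x" by (cases "v = 0") auto
    then show ?thesis using x(3) by simp
  qed
  with c(1) show ?thesis by blast
qed

text \<open>If \<open>x\<close> is a bounded preimage of \<open>v\<close>, then \<open>\<parallel>v\<parallel>\<^sup>2 = \<langle>v, A x\<rangle> = \<langle>A\<^sup>* v, x\<rangle> \<le> c \<parallel>A\<^sup>* v\<parallel> \<parallel>v\<parallel>\<close>.\<close>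

lemma adj_bounded_below_on_ran:
  assumes "closed (ran A)"
  shows "\<exists>c\<ge>0. \<forall>v\<in>dom (adj A) \<inter> ran A. norm v \<le> c * norm (adj A \<cdot> v)"
proof -
  obtain c where c: "c \<ge> 0" "\<And>y. y \<in> ran A \<Longrightarrow> \<exists>x\<in>dom A. A \<cdot> x = y \<and> norm x \<le> c * norm y"
    using bounded_preimages[OF assms] by blast
  have "norm v \<le> c * norm (adj A \<cdot> v)" if v: "v \<in> dom (adj A)" "v \<in> ran A" for v
  proof -
    obtain x where x: "x \<in> dom A" "A \<cdot> x = v" "norm x \<le> c * norm v"
      using c(2)[OF v(2)] by blast
    have "norm v * norm v = cmod (cinner v v)"
      by (simp add: cinner_self power2_eq_square norm_mult)
    also have "cinner v v = cinner (adj A \<cdot> v) x"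
      using cinner_adj[OF v(1) x(1)] x(2) by simp
    also have "cmod \<dots> \<le> norm (adj A \<cdot> v) * (c * norm v)"
      using order_trans[OF norm_cinner_le mult_left_mono[OF x(3) norm_ge_zero]] .
    finally show ?thesis by (cases "v = 0") (use c(1) in \<open>auto simp: mult.commute\<close>)
  qed
  with c(1) show ?thesis by blast
qed

end

lemma closed_operator_iff: "closed_operator A \<longleftrightarrow> closed_densely_defined A"
  by (auto simp: closed_operator_def linear_operator_def closed_operator_axioms_def
      closed_densely_defined_def)


section \<open>Boundedly invertible reductions and the dual of their domain\<close>

lemma norm_le_graph_norm: "norm (A \<cdot> v) \<le> graph_norm A v"
  by (simp add: graph_norm_def real_le_rsqrt)

lemma graph_norm_nonneg: "0 \<le> graph_norm A v"
  by (simp add: graph_norm_def)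

context linear_operator
begin

lemma diamond_in_dual: "diamond A \<phi> \<in> dom_dual A"
proof -
  have "cmod (cinner \<phi> (A \<cdot> v)) \<le> norm \<phi> * graph_norm A v" for v
    using order_trans[OF norm_cinner_le mult_left_mono[OF norm_le_graph_norm norm_ge_zero]] .
  moreover have "clinear_on (dom A) (diamond A \<phi>)"
    by (simp add: clinear_on_def diamond_def complex_vector.subspace_add[OF dom]
        complex_vector.subspace_scale[OF dom] clinear_on_add[OF lin] clinear_on_scaleC[OF lin]
        cinner_simps scaleC_complex_def)
  ultimately show ?thesis
    by (auto simp: normed_dual_def diamond_def)
qed

lemma weakly_converges_app:
  assumes x: "weakly_converges_dom A x l"
  shows "weakly_converges (\<lambda>n. A \<cdot> x n) (A \<cdot> l)"
  unfolding weakly_converges_iff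
proof
  fix h
  have "(\<lambda>n. diamond A h (x n)) \<longlonglongrightarrow> diamond A h l" and "l \<in> dom A" "\<And>n. x n \<in> dom A"
    using x diamond_in_dual[of h] unfolding weakly_converges_in_def by blast+
  then show "(\<lambda>n. cinner h (A \<cdot> x n)) \<longlonglongrightarrow> cinner h (A \<cdot> l)"
    unfolding diamond_def by simp
qed

end

text \<open>
  The common structure of \<open>red0 A\<close> and \<open>red1 A\<close>. The bounded inverse identifies the domain,
  with its graph norm, with the closed subspace \<open>R\<close>; so functionals on the domain are
  represented by vectors of \<open>R\<close>.
\<close>

locale reduced_operator = linear_operator B
  for B :: "'a::chilbert_space \<rightharpoonup> 'b::chilbert_space" +
  fixes R :: "'b set"
  assumes R: "csubspace R" "closed R" and bij: "bij_betw (\<lambda>x. B \<cdot> x) (dom B) R"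
    and bounded_below: "\<exists>c\<ge>0. \<forall>v\<in>dom B. norm v \<le> c * norm (B \<cdot> v)"
begin

definition B_inv :: "'b \<Rightarrow> 'a" where
  "B_inv = inv_into (dom B) (\<lambda>x. B \<cdot> x)"

lemma app_in_R: "v \<in> dom B \<Longrightarrow> B \<cdot> v \<in> R"
  using bij by (auto simp: bij_betw_def)

lemma B_inv [simp]:
  "r \<in> R \<Longrightarrow> B_inv r \<in> dom B" "r \<in> R \<Longrightarrow> B \<cdot> B_inv r = r"
  "v \<in> dom B \<Longrightarrow> B_inv (B \<cdot> v) = v"
  unfolding B_inv_def
  using bij_betw_inv_into_right[OF bij] bij_betw_inv_into_left[OF bij]
    bij_betw_apply[OF bij_betw_inv_into[OF bij]]
  by blast+

lemma ball_dom_iff: "(\<forall>v\<in>dom B. P (B \<cdot> v)) \<longleftrightarrow> (\<forall>r\<in>R. P r)"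
  using app_in_R B_inv by metis

lemma B_inv_clinear: "clinear_on R B_inv"
proof -
  have "B_inv (r + s) = B_inv r + B_inv s" if "r \<in> R" "s \<in> R" for r s
    using that B_inv(3)[of "B_inv r + B_inv s"]
    by (simp add: clinear_on_add[OF lin] complex_vector.subspace_add[OF dom])
  moreover have "B_inv (c *\<^sub>C r) = c *\<^sub>C B_inv r" if "r \<in> R" for r c
    using that B_inv(3)[of "c *\<^sub>C B_inv r"]
    by (simp add: clinear_on_scaleC[OF lin] complex_vector.subspace_scale[OF dom])
  ultimately show ?thesis by (simp add: clinear_on_def)
qed

lemma graph_norm_B_inv_le: "\<exists>c>0. \<forall>r\<in>R. graph_norm B (B_inv r) \<le> c * norm r"
proof -
  obtain c where c: "c \<ge> 0" "\<forall>v\<in>dom B. norm v \<le> c * norm (B \<cdot> v)"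
    using bounded_below by blast
  have "graph_norm B (B_inv r) \<le> (c + 1) * norm r" if "r \<in> R" for r
    using that c(2)[rule_format, of "B_inv r"]
      sqrt_sum_squares_le_sum[of "norm (B_inv r)" "norm r"]
    by (simp add: graph_norm_def distrib_right)
  then show ?thesis using c(1) by (intro exI[of _ "c + 1"]) auto
qed

lemma functional_graph_norm_le:
  assumes "\<forall>v\<in>dom B. cmod (f v) \<le> C * graph_norm B v"
  shows "\<exists>K\<ge>0. \<forall>r\<in>R. cmod (f (B_inv r)) \<le> K * norm r"
proof -
  obtain c where c: "c > 0" "\<forall>r\<in>R. graph_norm B (B_inv r) \<le> c * norm r"
    using graph_norm_B_inv_le by blast
  have "cmod (f (B_inv r)) \<le> (\<bar>C\<bar> * c) * norm r" if "r \<in> R" for r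
  proof -
    have "cmod (f (B_inv r)) \<le> C * graph_norm B (B_inv r)" using assms that by simp
    also have "\<dots> \<le> \<bar>C\<bar> * graph_norm B (B_inv r)"
      by (rule mult_right_mono) (simp_all add: graph_norm_nonneg)
    also have "\<dots> \<le> \<bar>C\<bar> * (c * norm r)"
      using c(2) that by (intro mult_left_mono) auto
    finally show ?thesis by (simp add: mult.assoc)
  qed
  then show ?thesis using c(1) by (intro exI[of _ "\<bar>C\<bar> * c"]) auto
qed

lemma dual_eq_diamond:
  assumes "f \<in> dom_dual B"
  shows "\<exists>\<phi>\<in>R. f = diamond B \<phi>"
proof -
  obtain C where f: "f \<in> extensional (dom B)" "clinear_on (dom B) f"
    and C: "\<forall>v\<in>dom B. cmod (f v) \<le> C * graph_norm B v"
    using assms by (auto simp: normed_dual_def)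
  obtain K where K: "\<forall>r\<in>R. cmod (f (B_inv r)) \<le> K * norm r"
    using functional_graph_norm_le[OF C] by blast
  have "clinear_on R (\<lambda>r. f (B_inv r))"
    using B_inv_clinear f(2) by (simp add: clinear_on_def)
  then obtain \<phi> where \<phi>: "\<phi> \<in> R" "\<forall>r\<in>R. f (B_inv r) = cinner \<phi> r"
    using Riesz_representation[OF R] K by blast
  have "f = diamond B \<phi>"
  proof (rule extensionalityI[OF f(1)])
    show "diamond B \<phi> \<in> extensional (dom B)" by (simp add: diamond_def)
    fix v assume v: "v \<in> dom B"
    have "f v = cinner \<phi> (B \<cdot> v)"
      using \<phi>(2)[rule_format, OF app_in_R[OF v]] unfolding B_inv(3)[OF v] .
    then show "f v = diamond B \<phi> v" using v unfolding diamond_def by simp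
  qed
  then show ?thesis using \<phi>(1) by blast
qed

lemma solves_diamond_iff:
  "solves a B (diamond B \<phi>) w \<longleftrightarrow> orth_proj R (a w) = orth_proj R \<phi>"
proof -
  have "solves a B (diamond B \<phi>) w \<longleftrightarrow> (\<forall>r\<in>R. cinner (a w) r = cinner \<phi> r)"
    unfolding ball_dom_iff[symmetric, of "\<lambda>r. cinner (a w) r = cinner \<phi> r"]
    by (auto simp: solves_def diamond_def)
  also have "\<dots> \<longleftrightarrow> orth_proj R (a w) = orth_proj R \<phi>"
    using orth_proj_in[OF R] cinner_orth_proj[OF R]
    by (auto intro!: orth_proj_eqI[OF R]) metis
  finally show ?thesis .
qed

lemma solution_diamond:
  assumes w: "w \<in> R" "orth_proj R (a w) = orth_proj R \<phi>"
    and unique: "\<And>w'. w' \<in> R \<Longrightarrow> orth_proj R (a w') = orth_proj R \<phi> \<Longrightarrow> w' = w"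
  shows "solution a B (diamond B \<phi>) = B_inv w"
  unfolding solution_def solves_diamond_iff
proof (rule the_equality)
  show "B_inv w \<in> dom B \<and> orth_proj R (a (B \<cdot> B_inv w)) = orth_proj R \<phi>"
    using w by simp
  fix u assume u: "u \<in> dom B \<and> orth_proj R (a (B \<cdot> u)) = orth_proj R \<phi>"
  then have "B \<cdot> u = w" using unique[OF app_in_R] by blast
  then show "u = B_inv w" using B_inv(3)[of u] u by metis
qed

text \<open>
  A functional on the larger domain of \<open>A\<close> pulls back along the bounded inverse to a functional
  on \<open>R\<close>, so weak convergence in \<open>R\<close> suffices for weak convergence of preimages in \<open>dom A\<close>.
\<close>

lemma weakly_converges_dom_B_inv:
  assumes A: "linear_operator A" "dom B \<subseteq> dom A" "\<And>v. v \<in> dom B \<Longrightarrow> A \<cdot> v = B \<cdot> v"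
    and w: "weakly_converges w_seq w" "\<And>n. w_seq n \<in> R" "w \<in> R"
  shows "weakly_converges_dom A (\<lambda>n. B_inv (w_seq n)) (B_inv w)"
  unfolding weakly_converges_in_def
proof (intro conjI allI ballI)
  show "B_inv w \<in> dom A" "B_inv (w_seq n) \<in> dom A" for n
    using w A(2) by (meson B_inv(1) subsetD)+
  fix f assume "f \<in> dom_dual A"
  then obtain C where f: "clinear_on (dom A) f" and C: "\<forall>v\<in>dom A. cmod (f v) \<le> C * graph_norm A v"
    by (auto simp: normed_dual_def)
  have "\<forall>v\<in>dom B. cmod (f v) \<le> C * graph_norm B v"
    using C A(2) unfolding graph_norm_def by (metis A(3) subsetD)
  then obtain K where K: "\<forall>r\<in>R. cmod (f (B_inv r)) \<le> K * norm r"
    using functional_graph_norm_le by blast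
  have "clinear_on R (\<lambda>r. f (B_inv r))"
    using B_inv_clinear clinear_on_subset[OF f A(2)] by (simp add: clinear_on_def)
  then obtain \<phi> where "\<phi> \<in> R" and \<phi>: "\<forall>r\<in>R. f (B_inv r) = cinner \<phi> r"
    using Riesz_representation[OF R] K by blast
  then show "(\<lambda>n. f (B_inv (w_seq n))) \<longlonglongrightarrow> f (B_inv w)"
    using weakly_convergesD(1)[OF w(1)] w(2,3) by simp
qed

lemma Metric_space_dom_dual: "Metric_space (dom_dual B) (dual_dist (dom B) (graph_norm B))"
  using complex_vector.subspace_0[OF dom] by (intro Metric_space_dual graph_norm_nonneg) blast

text \<open>Testing against the preimage of \<open>\<phi> - \<psi>\<close> shows that \<open>diamond B\<close> has a bounded inverse on \<open>R\<close>.\<close>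

lemma norm_diff_le_dual_dist:
  "\<exists>c>0. \<forall>\<phi>\<in>R. \<forall>\<psi>\<in>R.
     norm (\<phi> - \<psi>) \<le> c * dual_dist (dom B) (graph_norm B) (diamond B \<phi>) (diamond B \<psi>)"
proof -
  obtain c where c: "c > 0" "\<forall>r\<in>R. graph_norm B (B_inv r) \<le> c * norm r"
    using graph_norm_B_inv_le by blast
  have "norm (\<phi> - \<psi>) \<le> c * dual_dist (dom B) (graph_norm B) (diamond B \<phi>) (diamond B \<psi>)"
    if \<phi>: "\<phi> \<in> R" "\<psi> \<in> R" for \<phi> \<psi>
  proof (cases "\<phi> = \<psi>")
    case True
    then show ?thesis
      using Metric_space.nonneg[OF Metric_space_dom_dual] c(1) by simp
  next
    case False
    define r where "r = \<phi> - \<psi>"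
    have r: "r \<in> R" "norm r > 0"
      using \<phi> False by (simp_all add: r_def complex_vector.subspace_diff[OF R(1)])
    define h where "h v = diamond B \<phi> v - diamond B \<psi> v" for v
    have h: "h v = cinner r (B \<cdot> v)" if "v \<in> dom B" for v
      using that by (simp add: h_def diamond_def r_def cinner_simps)
    have bdd: "bdd_above ((\<lambda>v. cmod (h v) / graph_norm B v) ` dom B)"
    proof (rule bdd_aboveI2)
      fix v assume v: "v \<in> dom B"
      have "cmod (h v) \<le> norm r * graph_norm B v"
        unfolding h[OF v]
        using order_trans[OF norm_cinner_le mult_left_mono[OF norm_le_graph_norm norm_ge_zero]] .
      then show "cmod (h v) / graph_norm B v \<le> norm r"
        using graph_norm_nonneg[of B v] by (cases "graph_norm B v = 0") (simp_all add: pos_divide_le_eq)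
    qed
    have "dual_dist (dom B) (graph_norm B) (diamond B \<phi>) (diamond B \<psi>)
        = (SUP v\<in>dom B. cmod (h v) / graph_norm B v)"
      by (simp add: dual_dist_def dual_norm_def diamond_in_dual h_def)
    then have sup: "cmod (h (B_inv r)) / graph_norm B (B_inv r)
        \<le> dual_dist (dom B) (graph_norm B) (diamond B \<phi>) (diamond B \<psi>)"
      using cSUP_upper[OF B_inv(1)[OF r(1)] bdd] by simp
    have g: "0 < graph_norm B (B_inv r)"
      using less_le_trans[OF r(2)] norm_le_graph_norm[of B "B_inv r"] r(1) by simp
    have "norm r / c = (norm r)\<^sup>2 / (c * norm r)"
      using r(2) by (simp add: power2_eq_square)
    also have "\<dots> \<le> (norm r)\<^sup>2 / graph_norm B (B_inv r)"
      using c r g by (intro divide_left_mono) auto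
    also have "\<dots> = cmod (h (B_inv r)) / graph_norm B (B_inv r)"
      using r(1) by (simp add: h cinner_self norm_power)
    finally have "norm r / c \<le> dual_dist (dom B) (graph_norm B) (diamond B \<phi>) (diamond B \<psi>)"
      using sup by linarith
    then show ?thesis
      using c(1) by (simp add: r_def field_simps)
  qed
  with c(1) show ?thesis by blast
qed

text \<open>
  A sequence in a compact closure has a subsequence converging in the dual metric; its
  representatives are Cauchy by the previous estimate.
\<close>

lemma relatively_compact_diamond_imp_subseq:
  assumes \<phi>: "\<And>n. \<phi> n \<in> R" and r: "strict_mono (r :: nat \<Rightarrow> nat)"
    and compact: "relatively_compact_in (dom_dual_topology B) (range (\<lambda>n. diamond B (\<phi> n)))"
  shows "\<exists>s. strict_mono s \<and> convergent (\<lambda>n. \<phi> (r (s n)))"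
proof -
  interpret D: Metric_space "dom_dual B" "dual_dist (dom B) (graph_norm B)"
    by (rule Metric_space_dom_dual)
  let ?d = "dual_dist (dom B) (graph_norm B)"
  have *: "range (\<lambda>n. diamond B (\<phi> n)) \<subseteq> topspace D.mtopology"
    "compactin D.mtopology (D.mtopology closure_of range (\<lambda>n. diamond B (\<phi> n)))"
    using compact by (auto simp: relatively_compact_in_def dual_topology_def)
  have "range (\<lambda>n. diamond B (\<phi> (r n))) \<subseteq> D.mtopology closure_of range (\<lambda>n. diamond B (\<phi> n))"
    using closure_of_subset[OF *(1)] by blast
  then obtain l s where s: "strict_mono (s :: nat \<Rightarrow> nat)"
    and lim: "limitin D.mtopology ((\<lambda>n. diamond B (\<phi> (r n))) \<circ> s) l sequentially"
    using *(2) unfolding D.compactin_sequentially by metis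
  obtain c where c: "c > 0"
    "\<And>\<phi> \<psi>. \<phi> \<in> R \<Longrightarrow> \<psi> \<in> R \<Longrightarrow> norm (\<phi> - \<psi>) \<le> c * ?d (diamond B \<phi>) (diamond B \<psi>)"
    using norm_diff_le_dual_dist by blast
  have "Cauchy (\<lambda>n. \<phi> (r (s n)))"
  proof (rule metric_CauchyI)
    fix e :: real assume "e > 0"
    then have "e / c > 0" using c(1) by simp
    moreover have "D.MCauchy (\<lambda>n. diamond B (\<phi> (r (s n))))"
      using D.convergent_imp_MCauchy[OF _ lim] diamond_in_dual by (auto simp: o_def)
    ultimately obtain N where N: "\<And>m n. N \<le> m \<Longrightarrow> N \<le> n \<Longrightarrow>
        ?d (diamond B (\<phi> (r (s m)))) (diamond B (\<phi> (r (s n)))) < e / c"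
      unfolding D.MCauchy_def by blast
    have "dist (\<phi> (r (s m))) (\<phi> (r (s n))) < e" if "N \<le> m" "N \<le> n" for m n
      using c(2)[OF \<phi> \<phi>, of "r (s m)" "r (s n)"] N[OF that] c(1)
      by (simp add: dist_norm pos_less_divide_eq mult.commute)
    then show "\<exists>N. \<forall>m\<ge>N. \<forall>n\<ge>N. dist (\<phi> (r (s m))) (\<phi> (r (s n))) < e" by blast
  qed
  then show ?thesis
    using s Cauchy_convergent by blast
qed

lemma relatively_compact_diamond_const:
  "relatively_compact_in (dom_dual_topology B) (range (\<lambda>n::nat. diamond B \<phi>))"
proof -
  interpret D: Metric_space "dom_dual B" "dual_dist (dom B) (graph_norm B)"
    by (rule Metric_space_dom_dual)
  have "diamond B \<phi> \<in> topspace D.mtopology"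
    using diamond_in_dual by simp
  moreover from this have "closedin D.mtopology {diamond B \<phi>}"
    using D.t1_space_mtopology by (simp add: t1_space_closedin_singleton)
  ultimately show ?thesis
    by (simp add: relatively_compact_in_def dual_topology_def closure_of_closedin)
qed

end

lemma (in linear_operator) restrict_reduced_operator:
  assumes S: "csubspace S" and R: "csubspace R" "closed R"
    and into: "\<And>x. x \<in> dom A \<inter> S \<Longrightarrow> A \<cdot> x \<in> R"
    and onto: "\<And>y. y \<in> R \<Longrightarrow> \<exists>x\<in>dom A \<inter> S. A \<cdot> x = y"
    and bounded_below: "\<exists>c\<ge>0. \<forall>v\<in>dom A \<inter> S. norm v \<le> c * norm (A \<cdot> v)"
  shows "reduced_operator (A |` S) R"
proof -
  have csub: "csubspace (dom A \<inter> S)"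
    using dom S by (rule complex_vector.subspace_inter)
  obtain c where c: "\<And>v. v \<in> dom A \<inter> S \<Longrightarrow> norm v \<le> c * norm (A \<cdot> v)"
    using bounded_below by blast
  have "inj_on (\<lambda>x. A \<cdot> x) (dom A \<inter> S)"
  proof (rule inj_onI)
    fix u v assume uv: "u \<in> dom A \<inter> S" "v \<in> dom A \<inter> S" "A \<cdot> u = A \<cdot> v"
    then show "u = v"
      using c[OF complex_vector.subspace_diff[OF csub uv(1,2)]] clinear_on_diff[OF dom lin, of u v]
      by simp
  qed
  then have bij: "bij_betw (\<lambda>x. A \<cdot> x) (dom A \<inter> S) R"
    unfolding bij_betw_def using into onto by blast
  have clin: "clinear_on (dom A \<inter> S) (\<lambda>x. A \<cdot> x)"
    by (rule clinear_on_subset[OF lin]) blast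
  have app: "(A |` S) \<cdot> v = A \<cdot> v" if "v \<in> dom A \<inter> S" for v
    using that by simp
  show ?thesis
  proof unfold_locales
    show "csubspace (dom (A |` S))" using csub by simp
    show "clinear_on (dom (A |` S)) (\<lambda>x. (A |` S) \<cdot> x)"
      using clin unfolding dom_restrict clinear_on_def
      using complex_vector.subspace_add[OF csub] complex_vector.subspace_scale[OF csub] app
      by simp
    show "bij_betw (\<lambda>x. (A |` S) \<cdot> x) (dom (A |` S)) R"
      unfolding dom_restrict using bij by (subst bij_betw_cong[OF app])
    show "\<exists>c\<ge>0. \<forall>v\<in>dom (A |` S). norm v \<le> c * norm ((A |` S) \<cdot> v)"
      unfolding dom_restrict using bounded_below app by simp
  qed (use R in auto)
qed

context closed_operator
begin

theorem red0_reduced_operator: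
  assumes "closed (ran A)"
  shows "reduced_operator (red0 A) (ran A)"
  unfolding red0_def
proof (rule restrict_reduced_operator)
  show "csubspace (ran (adj A))"
    by (rule linear_operator.csubspace_ran[OF adj_linear_operator])
  show "\<exists>c\<ge>0. \<forall>v\<in>dom A \<inter> ran (adj A). norm v \<le> c * norm (A \<cdot> v)"
    by (rule bounded_below_on_kern_perp[OF assms])
  show "A \<cdot> x \<in> ran A" if "x \<in> dom A \<inter> ran (adj A)" for x
    using that by (intro app_in_ran) blast
  \<comment> \<open>removing the component in \<open>ker A\<close> from a preimage does not change its image\<close>
  fix y assume "y \<in> ran A"
  then obtain x where x: "x \<in> dom A" "A \<cdot> x = y" by (rule ran_obtain)
  define k where "k = orth_proj (kern A) x"
  have k: "k \<in> dom A" "A \<cdot> k = 0"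
    using orth_proj_in[OF csubspace_kern closed_kern, of x] by (simp_all add: k_def kern_iff)
  have "x - k \<in> ran (adj A)"
    unfolding ran_adj[OF assms]
    by (simp add: k_def cinner_simps cinner_orth_proj[OF csubspace_kern closed_kern])
  moreover have "x - k \<in> dom A" "A \<cdot> (x - k) = y"
    using x k by (simp_all add: complex_vector.subspace_diff[OF dom] clinear_on_diff[OF dom lin])
  ultimately show "\<exists>x\<in>dom A \<inter> ran (adj A). A \<cdot> x = y" by blast
qed (fact csubspace_ran assms)+

theorem red1_reduced_operator:
  assumes "closed (ran A)" "closed (ran (adj A))"
  shows "reduced_operator (red1 A) (ran (adj A))"
  unfolding red1_def
proof (rule linear_operator.restrict_reduced_operator[OF adj_linear_operator])
  show "\<exists>c\<ge>0. \<forall>v\<in>dom (adj A) \<inter> ran A. norm v \<le> c * norm (adj A \<cdot> v)"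
    by (rule adj_bounded_below_on_ran[OF assms(1)])
  show "adj A \<cdot> x \<in> ran (adj A)" if "x \<in> dom (adj A) \<inter> ran A" for x
    using that by (intro app_in_ran) blast
  fix y assume "y \<in> ran (adj A)"
  then obtain z where z: "z \<in> ran A" "adj A z = Some y"
    using adj_preimage_in_ran[OF assms(1), of y] unfolding ran_adj[OF assms(1)] by blast
  then show "\<exists>x\<in>dom (adj A) \<inter> ran A. adj A \<cdot> x = y"
    by (intro bexI[of _ z]) auto
qed (fact csubspace_ran linear_operator.csubspace_ran[OF adj_linear_operator] assms)+

end

section \<open>Nonlocal H-convergence and the product condition\<close>

context
  fixes A0 :: "'h0::chilbert_space \<rightharpoonup> 'h1::chilbert_space"
    and A1 :: "'h1 \<rightharpoonup> 'h2::chilbert_space"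
  assumes A0: "closed_densely_defined A0" and A1: "closed_densely_defined A1"
    and exact: "closed_exact A0 A1"
begin

lemma orthogonal_pair_ranges: "orthogonal_pair (ran A0) (ran (adj A1))"
proof -
  interpret A0: closed_operator A0 using A0 by (simp add: closed_operator_iff)
  interpret A1: closed_operator A1 using A1 by (simp add: closed_operator_iff)
  show ?thesis
    using exact A0.csubspace_ran A1.ran_adj
    by (auto simp: closed_exact_def orthogonal_pair_def)
qed

lemma red0_reduced: "reduced_operator (red0 A0) (ran A0)"
  using closed_operator.red0_reduced_operator[of A0] A0 exact
  unfolding closed_operator_iff closed_exact_def by blast

lemma red1_reduced: "reduced_operator (red1 A1) (ran (adj A1))"
  using closed_operator.red1_reduced_operator[of A1] A1 exact
    orthogonal_pair.closed1[OF orthogonal_pair_ranges]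
  unfolding closed_operator_iff closed_exact_def by blast

interpretation H: orthogonal_pair "ran A0" "ran (adj A1)"
  by (rule orthogonal_pair_ranges)

interpretation B0: reduced_operator "red0 A0" "ran A0"
  by (rule red0_reduced)

interpretation B1: reduced_operator "red1 A1" "ran (adj A1)"
  by (rule red1_reduced)

lemma M_class_eq: "M_class \<alpha> \<beta> A0 A1 = H.M \<alpha> \<beta>"
  by (simp add: M_class_def H.M_def Let_def)

lemma dom_red: "dom (red0 A0) \<subseteq> dom A0" "dom (red1 A1) \<subseteq> dom (adj A1)"
  by (simp_all add: red0_def red1_def)

lemma app_red: "v \<in> dom (red0 A0) \<Longrightarrow> A0 \<cdot> v = red0 A0 \<cdot> v"
    "w \<in> dom (red1 A1) \<Longrightarrow> adj A1 \<cdot> w = red1 A1 \<cdot> w"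
  by (auto simp: red0_def red1_def restrict_map_def split: if_splits)

lemma app_B_inv: "x \<in> ran A0 \<Longrightarrow> A0 \<cdot> B0.B_inv x = x"
    "y \<in> ran (adj A1) \<Longrightarrow> adj A1 \<cdot> B1.B_inv y = y"
  using app_red B0.B_inv B1.B_inv by metis+

lemma linear_operators: "linear_operator A0" "linear_operator (adj A1)"
  using A0 A1 closed_operator.adj_linear_operator[of A1]
  by (simp_all add: closed_operator_def flip: closed_operator_iff)

text \<open>
  The two families of problems in the definition of nonlocal H-convergence are the mixed
  problem with data in \<open>ran A0\<close> and in \<open>ran (adj A1)\<close>, respectively.
\<close>

lemma
  assumes a: "a \<in> H.M \<alpha> \<beta>" and pos: "\<alpha> > 0" "\<beta> > 0"
  shows flux0_unique: "w \<in> ran A0 \<Longrightarrow> H.P0 (a w) = H.P0 x \<Longrightarrow> w = H.mixed_inv a (H.P0 x)"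
    and solution0: "solution a (red0 A0) (diamond (red0 A0) x) = B0.B_inv (H.mixed_inv a (H.P0 x))"
    and flux0_in: "H.mixed_inv a (H.P0 x) \<in> ran A0"
    and flux1_unique: "z \<in> ran (adj A1) \<Longrightarrow> H.P1 (inv a z) = H.P1 x \<Longrightarrow>
      z = a (H.mixed_inv a (H.P1 x))"
    and solution1: "solution (inv a) (red1 A1) (diamond (red1 A1) x) =
      B1.B_inv (a (H.mixed_inv a (H.P1 x)))"
    and flux1_in: "a (H.mixed_inv a (H.P1 x)) \<in> ran (adj A1)"
proof -
  note inv = H.M_D(3)[OF a pos]
  have "bij a" using H.M_D(1)[OF a pos] by (simp add: cont_invertible_def)
  then have a_inv: "a (inv a z) = z" "inv a (a z) = z" for z
    by (simp_all add: surj_f_inv_f bij_is_surj bij_is_inj)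
  note P_T = H.P_mixed_inv[OF inv]
  show unique0: "w = H.mixed_inv a (H.P0 x)" if "w \<in> ran A0" "H.P0 (a w) = H.P0 x" for w
    using H.mixed_inv_eqI[OF inv, of w "H.P0 x"] that by simp
  show in0: "H.mixed_inv a (H.P0 x) \<in> ran A0"
    by (rule H.in_R) (simp add: P_T)
  show "solution a (red0 A0) (diamond (red0 A0) x) = B0.B_inv (H.mixed_inv a (H.P0 x))"
    by (rule B0.solution_diamond[OF in0]) (use unique0 in \<open>simp_all add: P_T\<close>)
  show unique1: "z = a (H.mixed_inv a (H.P1 x))" if "z \<in> ran (adj A1)" "H.P1 (inv a z) = H.P1 x" for z
    using H.mixed_inv_eqI[OF inv, of "inv a z" "H.P1 x"] that by (simp add: a_inv)
  show in1: "a (H.mixed_inv a (H.P1 x)) \<in> ran (adj A1)"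
    by (rule H.in_R) (simp add: P_T)
  show "solution (inv a) (red1 A1) (diamond (red1 A1) x) = B1.B_inv (a (H.mixed_inv a (H.P1 x)))"
    by (rule B1.solution_diamond[OF in1]) (use unique1 in \<open>simp_all add: P_T a_inv\<close>)
qed

text \<open>
  For the solutions \<open>u\<^sub>n\<close>, which lie in the reduced domain, weak convergence in \<open>dom A0\<close> amounts
  to weak convergence of \<open>A0 u\<^sub>n\<close>; the same holds for \<open>v\<^sub>n\<close> and \<open>adj A1\<close>. Data
  in \<open>ran A0\<close> and in \<open>ran (adj A1)\<close> together span the space, so by linearity the two families of
  problems control the mixed inverses at every \<open>x = P0 x + P1 x\<close>.
\<close>

theorem nonlocal_H_converges_iff_mixed_converges:
  assumes a_seq: "\<And>n. a_seq n \<in> M_class \<alpha> \<beta> A0 A1" and a: "a \<in> M_class \<alpha> \<beta> A0 A1"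
    and pos: "\<alpha> > 0" "\<beta> > 0"
  shows "nonlocal_H_converges A0 A1 a_seq a \<longleftrightarrow> H.mixed_converges a_seq a"
proof -
  note a_seq = a_seq[unfolded M_class_eq] and a = a[unfolded M_class_eq]
  let ?T = "\<lambda>n. H.mixed_inv (a_seq n)" and ?S = "H.mixed_inv a"
  have bij: "bij b" if "b \<in> H.M \<alpha> \<beta>" for b
    using H.M_D(1)[OF that pos] by (simp add: cont_invertible_def)
  have inv_app: "inv b (b x) = x" if "b \<in> H.M \<alpha> \<beta>" for b x
    using bij[OF that] by (simp add: bij_is_inj)
  have app_inv: "b (inv b x) = x" if "b \<in> H.M \<alpha> \<beta>" for b x
    using bij[OF that] by (simp add: surj_f_inv_f bij_is_surj)
  show ?thesis
  proof
    assume conv: "H.mixed_converges a_seq a"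
    show "nonlocal_H_converges A0 A1 a_seq a"
      unfolding nonlocal_H_converges_def Let_def
    proof (intro conjI ballI)
      show "cont_invertible UNIV a" by (rule H.M_D(1)[OF a pos])
      fix f g assume "f \<in> dom_dual (red0 A0)" "g \<in> dom_dual (red1 A1)"
      then obtain x y where f: "f = diamond (red0 A0) x" and g: "g = diamond (red1 A1) y"
        using B0.dual_eq_diamond B1.dual_eq_diamond by blast
      let ?u = "B0.B_inv (?S (H.P0 x))" and ?v = "B1.B_inv (a (?S (H.P1 y)))"
      note sols = solution0[OF a_seq pos] solution1[OF a_seq pos]
      note ins = flux0_in[OF a_seq pos] flux1_in[OF a_seq pos] flux0_in[OF a pos] flux1_in[OF a pos]
      have "weakly_converges_dom A0 (\<lambda>n. B0.B_inv (?T n (H.P0 x))) ?u"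
        using conv ins dom_red app_red
        by (intro B0.weakly_converges_dom_B_inv linear_operators) (auto simp: H.mixed_converges_def)
      moreover have "weakly_converges_dom (adj A1) (\<lambda>n. B1.B_inv (a_seq n (?T n (H.P1 y)))) ?v"
        using conv ins dom_red app_red
        by (intro B1.weakly_converges_dom_B_inv linear_operators) (auto simp: H.mixed_converges_def)
      moreover have "solves a (red0 A0) f (A0 \<cdot> ?u)"
        using ins by (simp add: f B0.solves_diamond_iff app_B_inv H.P_mixed_inv[OF H.M_D(3)[OF a pos]])
      moreover have "solves (inv a) (red1 A1) g (adj A1 \<cdot> ?v)"
        using ins by (simp add: g B1.solves_diamond_iff app_B_inv inv_app[OF a]
            H.P_mixed_inv[OF H.M_D(3)[OF a pos]])
      moreover have "weakly_converges (\<lambda>n. a_seq n (?T n (H.P0 x))) (a (?S (H.P0 x)))"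
          "weakly_converges (\<lambda>n. ?T n (H.P1 y)) (?S (H.P1 y))"
        using conv by (simp_all add: H.mixed_converges_def)
      ultimately show "\<exists>u v.
          weakly_converges_dom A0 (\<lambda>n. solution (a_seq n) (red0 A0) f) u \<and>
          weakly_converges_dom (adj A1) (\<lambda>n. solution (inv (a_seq n)) (red1 A1) g) v \<and>
          weakly_converges (\<lambda>n. a_seq n (A0 \<cdot> solution (a_seq n) (red0 A0) f)) (a (A0 \<cdot> u)) \<and>
          weakly_converges (\<lambda>n. inv (a_seq n) (adj A1 \<cdot> solution (inv (a_seq n)) (red1 A1) g))
            (inv a (adj A1 \<cdot> v)) \<and>
          solves a (red0 A0) f (A0 \<cdot> u) \<and> solves (inv a) (red1 A1) g (adj A1 \<cdot> v)"
        using ins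
        by (intro exI[of _ ?u] exI[of _ ?v])
          (simp add: f g sols app_B_inv inv_app[OF a] inv_app[OF a_seq])
    qed
  next
    assume conv: "nonlocal_H_converges A0 A1 a_seq a"
    show "H.mixed_converges a_seq a"
      unfolding H.mixed_converges_def
    proof
      fix x
      let ?f = "diamond (red0 A0) x" and ?g = "diamond (red1 A1) x"
      obtain u v where
        u: "weakly_converges_dom A0 (\<lambda>n. solution (a_seq n) (red0 A0) ?f) u" and
        v: "weakly_converges_dom (adj A1) (\<lambda>n. solution (inv (a_seq n)) (red1 A1) ?g) v" and
        au: "weakly_converges (\<lambda>n. a_seq n (A0 \<cdot> solution (a_seq n) (red0 A0) ?f)) (a (A0 \<cdot> u))" and
        av: "weakly_converges (\<lambda>n. inv (a_seq n) (adj A1 \<cdot> solution (inv (a_seq n)) (red1 A1) ?g))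
            (inv a (adj A1 \<cdot> v))" and
        sol: "solves a (red0 A0) ?f (A0 \<cdot> u)" "solves (inv a) (red1 A1) ?g (adj A1 \<cdot> v)"
        using conv B0.diamond_in_dual[of x] B1.diamond_in_dual[of x]
        unfolding nonlocal_H_converges_def Let_def by blast
      have ran: "A0 \<cdot> u \<in> ran A0" "adj A1 \<cdot> v \<in> ran (adj A1)"
        using u v by (auto simp: weakly_converges_in_def intro: app_in_ran simp del: domIff)
      have lim: "A0 \<cdot> u = ?S (H.P0 x)" "adj A1 \<cdot> v = a (?S (H.P1 x))"
        using sol ran flux0_unique[OF a pos] flux1_unique[OF a pos]
        by (simp_all add: B0.solves_diamond_iff B1.solves_diamond_iff)
      note eqs = solution0[OF a_seq pos] solution1[OF a_seq pos] app_B_inv lim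
        flux0_in[OF a_seq pos] flux1_in[OF a_seq pos] inv_app[OF a] inv_app[OF a_seq]
      have weak: "weakly_converges (\<lambda>n. ?T n (H.P0 x)) (?S (H.P0 x))"
          "weakly_converges (\<lambda>n. ?T n (H.P1 x)) (?S (H.P1 x))"
          "weakly_converges (\<lambda>n. a_seq n (?T n (H.P0 x))) (a (?S (H.P0 x)))"
          "weakly_converges (\<lambda>n. a_seq n (?T n (H.P1 x))) (a (?S (H.P1 x)))"
        using linear_operator.weakly_converges_app[OF linear_operators(1) u] av au
          linear_operator.weakly_converges_app[OF linear_operators(2) v]
        by (simp_all add: eqs)
      have split: "H.mixed_inv b x = H.mixed_inv b (H.P0 x) + H.mixed_inv b (H.P1 x)"
        "b (H.mixed_inv b x) = b (H.mixed_inv b (H.P0 x)) + b (H.mixed_inv b (H.P1 x))"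
        if "b \<in> H.M \<alpha> \<beta>" for b
      proof -
        have "clinear_on UNIV b" using H.M_D(2)[OF that pos] by (simp add: bounded_ops_def)
        moreover show sum: "H.mixed_inv b x = H.mixed_inv b (H.P0 x) + H.mixed_inv b (H.P1 x)"
          using clinear_on_add[OF H.mixed_inv_clinear[OF H.M_D(3)[OF that pos]], of "H.P0 x" "H.P1 x"]
          by (simp add: H.P_sum)
        ultimately show "b (H.mixed_inv b x) = b (H.mixed_inv b (H.P0 x)) + b (H.mixed_inv b (H.P1 x))"
          using clinear_on_add[of UNIV b] by (simp add: sum)
      qed
      have sum: "weakly_converges (\<lambda>n. p n + q n) (l + m)"
        if "weakly_converges p l" "weakly_converges q m" for p q :: "nat \<Rightarrow> 'h1" and l m
        using that by (simp add: weakly_converges_iff cinner_add_right tendsto_add)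
      show "weakly_converges (\<lambda>n. ?T n x) (?S x) \<and> weakly_converges (\<lambda>n. a_seq n (?T n x)) (a (?S x))"
        using sum[OF weak(1,2)] sum[OF weak(3,4)]
        unfolding split[OF a_seq, symmetric] split[OF a, symmetric] by blast
    qed
  qed
qed

text \<open>
  Relatively compact images under the diamond maps give norm convergent subsequences of the
  projections. For the converse, the sequences \<open>q\<^sub>n = T n x\<close> have constant images, and
  singletons are compact.
\<close>

theorem nonlocal_H_converges_iff_product_converges:
  fixes a_seq :: "nat \<Rightarrow> 'h1 \<Rightarrow> 'h1"
  assumes pos: "\<alpha> > 0" "\<beta> > 0" and a_seq: "\<And>n. a_seq n \<in> M_class \<alpha> \<beta> A0 A1"
    and bounded: "\<exists>C. \<forall>n. onorm (a_seq n) \<le> C" and a: "a \<in> bounded_ops UNIV UNIV"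
    and sep: "separable_space (euclidean :: 'h1 topology)"
  shows "(a \<in> M_class \<alpha> \<beta> A0 A1 \<and> nonlocal_H_converges A0 A1 a_seq a) \<longleftrightarrow>
    (\<forall>(q_seq :: nat \<Rightarrow> 'h1) q (\<kappa> :: nat \<Rightarrow> nat).
       weakly_converges q_seq q \<longrightarrow> strict_mono \<kappa> \<longrightarrow>
       relatively_compact_in (dom_dual_topology (red0 A0))
         (range (\<lambda>n. diamond_k0 A0 (a_seq (\<kappa> n) (q_seq n)))) \<longrightarrow>
       relatively_compact_in (dom_dual_topology (red1 A1))
         (range (\<lambda>n. diamond_k1 A1 (q_seq n))) \<longrightarrow>
       weakly_converges (\<lambda>n. a_seq (\<kappa> n) (q_seq n)) (a q))"
    (is "_ \<longleftrightarrow> ?products")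
proof -
  obtain C where C: "\<And>n. onorm (a_seq n) \<le> C" using bounded by blast
  interpret S: bounded_M_sequence "ran A0" "ran (adj A1)" a_seq \<alpha> \<beta> C
  proof
    show M: "a_seq n \<in> H.M \<alpha> \<beta>" for n
      using a_seq by (simp add: M_class_eq)
    have lin: "bounded_linear (a_seq n)" for n
      by (rule bounded_ops_imp_bounded_linear[OF H.M_D(2)[OF M pos]])
    show "0 \<le> C"
      using onorm_pos_le[OF lin, of 0] C[of 0] by linarith
    show "norm (a_seq n x) \<le> C * norm x" for n x
      by (rule order_trans[OF onorm[OF lin] mult_right_mono[OF C norm_ge_zero]])
  qed (fact pos)+
  show ?thesis
  proof (intro iffI allI impI)
    fix q_seq :: "nat \<Rightarrow> 'h1" and q \<kappa>
    assume *: "a \<in> M_class \<alpha> \<beta> A0 A1 \<and> nonlocal_H_converges A0 A1 a_seq a"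
      and q: "weakly_converges q_seq q" and \<kappa>: "strict_mono \<kappa>"
      and compact0: "relatively_compact_in (dom_dual_topology (red0 A0))
         (range (\<lambda>n. diamond_k0 A0 (a_seq (\<kappa> n) (q_seq n))))"
      and compact1: "relatively_compact_in (dom_dual_topology (red1 A1))
         (range (\<lambda>n. diamond_k1 A1 (q_seq n)))"
    have "a \<in> H.M \<alpha> \<beta>" "H.mixed_converges a_seq a"
      using * nonlocal_H_converges_iff_mixed_converges[OF a_seq _ pos] by (auto simp: M_class_eq)
    then show "weakly_converges (\<lambda>n. a_seq (\<kappa> n) (q_seq n)) (a q)"
      using q \<kappa>
    proof (rule S.mixed_converges_imp_product_converges)
      show "\<exists>s. strict_mono s \<and> convergent (\<lambda>n. H.P0 (a_seq (\<kappa> (r (s n))) (q_seq (r (s n)))))"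
        if "strict_mono r" for r :: "nat \<Rightarrow> nat"
        by (rule B0.relatively_compact_diamond_imp_subseq
              [of "\<lambda>n. H.P0 (a_seq (\<kappa> n) (q_seq n))", OF _ that compact0[unfolded diamond_k0_def]])
          simp
      show "\<exists>s. strict_mono s \<and> convergent (\<lambda>n. H.P1 (q_seq (r (s n))))"
        if "strict_mono r" for r :: "nat \<Rightarrow> nat"
        by (rule B1.relatively_compact_diamond_imp_subseq
              [of "\<lambda>n. H.P1 (q_seq n)", OF _ that compact1[unfolded diamond_k1_def]]) simp
    qed
  next
    assume products: ?products
    have product: "weakly_converges (\<lambda>n. a_seq (\<kappa> n) (q_seq n)) (a q)"
      if "weakly_converges q_seq q" "strict_mono \<kappa>" "\<And>n. H.P0 (a_seq (\<kappa> n) (q_seq n)) = y0"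
        "\<And>n. H.P1 (q_seq n) = y1" for q_seq q \<kappa> y0 y1
      using products that B0.relatively_compact_diamond_const B1.relatively_compact_diamond_const
      by (simp add: diamond_k0_def diamond_k1_def)
    have "a \<in> H.M \<alpha> \<beta>"
      by (rule S.product_converges_imp_M[OF sep a product])
    moreover have "H.mixed_converges a_seq a"
      by (rule S.product_converges_imp_mixed_converges[OF sep a product])
    ultimately show "a \<in> M_class \<alpha> \<beta> A0 A1 \<and> nonlocal_H_converges A0 A1 a_seq a"
      using nonlocal_H_converges_iff_mixed_converges[OF a_seq _ pos] by (simp add: M_class_eq)
  qed
qed

end

theorem theorem6p2:
  fixes A0 :: "'h0::chilbert_space \<rightharpoonup> 'h1::chilbert_space"
    and A1 :: "'h1 \<rightharpoonup> 'h2::chilbert_space"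
    and a_seq :: "nat \<Rightarrow> 'h1 \<Rightarrow> 'h1" and a :: "'h1 \<Rightarrow> 'h1"
    and \<alpha> \<beta> :: real
  assumes "closed_densely_defined A0" and "closed_densely_defined A1"
    and "closed_exact A0 A1"
    and "\<alpha> > 0" and "\<beta> > 0"
    and "\<And>n. a_seq n \<in> M_class \<alpha> \<beta> A0 A1"
    and "\<exists>C. \<forall>n. onorm (a_seq n) \<le> C"
    and "a \<in> bounded_ops UNIV UNIV"
    and "separable_space (euclidean :: 'h1 topology)"
  shows "(a \<in> M_class \<alpha> \<beta> A0 A1 \<and> nonlocal_H_converges A0 A1 a_seq a) \<longleftrightarrow>
    (\<forall>(q_seq :: nat \<Rightarrow> 'h1) q (\<kappa> :: nat \<Rightarrow> nat).
       weakly_converges q_seq q \<longrightarrow> strict_mono \<kappa> \<longrightarrow>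
       relatively_compact_in (dom_dual_topology (red0 A0))
         (range (\<lambda>n. diamond_k0 A0 (a_seq (\<kappa> n) (q_seq n)))) \<longrightarrow>
       relatively_compact_in (dom_dual_topology (red1 A1))
         (range (\<lambda>n. diamond_k1 A1 (q_seq n))) \<longrightarrow>
       weakly_converges (\<lambda>n. a_seq (\<kappa> n) (q_seq n)) (a q))"
  by (rule nonlocal_H_converges_iff_product_converges) fact+

end
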